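(* Let $G$ be a plane graph and let $A\subseteq E(G)$. Then the partial dual $G^A$ is bipartite if and only if $A$ is the set of $c$-edges arising from an all-crossing direction of the medial graph $G_m$.
   Context: Graphs are finite and may have loops and multiple edges. A plane graph is a graph cellularly embedded in the sphere, i.e. every region (component of the complement) is an open disc; in particular it is connected. An embedded graph is bipartite if its underlying abstract graph is. Ribbon graphs and partial duals. A ribbon graph $G=(V(G),E(G))$ is a (possibly non-orientable) surface with boundary, represented as the union of a set $V(G)$ of discs (vertices) and a set $E(G)$ of discs (edges) such that vertices and edges meet in disjoint line segments, each such segment lies on the boundary of exactly one vertex and exactly one edge, and every edge contains exactly two such segments. Ribbon graphs are equivalent to cellularly embedded graphs (take a neighbourhood of the embedded graph; conversely, glue discs to the boundary components), and one moves freely between them. The geometric dual of a ribbon graph $G$ is $G^*=(V(G^* ),E(G))$, where $V(G^* )$ is a set of discs filling in the boundary components of $G$. An arrow-marked ribbon graph is a ribbon graph with coloured arrows on the boundaries of its vertices, disjoint from the edges, with exactly two arrows of each colour. For $B\subseteq E(G)$, $G\,\vec{-}\,B$ is the arrow-marked ribbon graph obtained by, for each $e\in B$, orienting the boundary of $e$ arbitrarily, placing on each of the two arcs where $e$ meets vertices an arrow coloured $e$ following this orientation, and deleting $e$. Conversely, if $H$ is an arrow-marked ribbon graph with label set $B$, $H\,\vec{+}\,B$ is obtained by, for each $e\in B$, taking a disc with oriented boundary and identifying two disjoint arcs of its boundary with the two arrows coloured $e$ consistently with the orientation; the disc becomes an edge $e$. The geometric dual of an arrow-marked ribbon graph is the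 geometric dual of the underlying ribbon graph with the inherited marking arrows. With $A^c=E(G)\setminus A$, the partial dual is $G^A:=(G\,\vec{-}\,A^c)^*\,\vec{+}\,A^c$. Medial graphs. The medial graph $G_m$ of a plane graph $G$ is the $4$-regular plane graph obtained by placing a vertex on each edge of $G$ and joining two such vertices by an edge embedded in a face whenever the edges of $G$ on which they lie are adjacent (consecutive) edges of that face. Each vertex of $G$ corresponds to a face of $G_m$; colouring these faces black and all other faces white gives the canonical face $2$-colouring of $G_m$. An all-crossing direction of $G_m$ is an assignment of a direction to each edge of $G_m$ such that at each vertex of $G_m$ the incident edge-ends read in cyclic order are (head, head, tail, tail). Given an all-crossing direction, a vertex $w$ of $G_m$ is a $c$-vertex if at each of the two black face corners at $w$ the two bounding edge-ends are both heads or both tails; it is a $d$-vertex if at each of the two black corners at $w$ one bounding edge-end is a head and the other is a tail. (Exactly one of these holds at each vertex.) An edge of $G$ is a $c$-edge (respectively $d$-edge) if the corresponding vertex of $G_m$ is a $c$-vertex (respectively $d$-vertex). *)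

theory Defs
  imports Main
begin

section \<open>Arrow-marked ribbon graphs\<close>

text \<open>
  The boundary of a vertex disc meets the edge discs and the marking arrows in disjoint arcs. A
  ribbon graph is encoded by the set \<open>points\<close> of the end points of all these arcs: \<open>arc p\<close> is the
  other end point of the arc containing \<open>p\<close>, and \<open>gap p\<close> is the point joined to \<open>p\<close> by a piece of
  vertex boundary that is free of edges and arrows. If \<open>p\<close> lies on an edge disc, then \<open>side p\<close> is
  the point joined to \<open>p\<close> by one of the two free sides of that disc, so the boundary of the edge
  disc runs through \<open>p\<close>, \<open>arc p\<close>, \<open>side (arc p)\<close>, \<open>side p\<close>. No orientability is assumed.

  The field \<open>label\<close> gives the edge, or the colour of the arrow, on which a point lies. An arrow is
  an arc whose label is in \<open>marks\<close>; the end point of it that belongs to \<open>heads\<close> is its head. Vertex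
  discs that meet neither edges nor arrows contribute no points; \<open>bare\<close> is the number of them.
\<close>

record ('p, 'e) ribbon =
  points :: "'p set"
  arc :: "'p \<Rightarrow> 'p"
  gap :: "'p \<Rightarrow> 'p"
  side :: "'p \<Rightarrow> 'p"
  label :: "'p \<Rightarrow> 'e"
  edges :: "'e set"
  marks :: "'e set"
  heads :: "'p set"
  bare :: nat

definition arrow_marked_ribbon_graph :: "('p, 'e) ribbon \<Rightarrow> bool" where
  "arrow_marked_ribbon_graph G \<longleftrightarrow>
     finite (points G) \<and> finite (edges G) \<and> finite (marks G) \<and> edges G \<inter> marks G = {} \<and>
     (\<forall>p\<in>points G. arc G p \<in> points G \<and> arc G p \<noteq> p \<and> arc G (arc G p) = p) \<and>
     (\<forall>p\<in>points G. gap G p \<in> points G \<and> gap G p \<noteq> p \<and> gap G (gap G p) = p) \<and>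
     (\<forall>p\<in>points G. label G p \<in> edges G \<union> marks G \<and> label G (arc G p) = label G p) \<and>
     (\<forall>e\<in>edges G \<union> marks G. card {p \<in> points G. label G p = e} = 4) \<and>
     (\<forall>p\<in>points G. label G p \<in> edges G \<longrightarrow>
        side G p \<in> points G \<and> side G p \<noteq> p \<and> side G p \<noteq> arc G p \<and>
        side G (side G p) = p \<and> side G (arc G p) = arc G (side G p) \<and>
        label G (side G p) = label G p) \<and>
     heads G \<subseteq> {p \<in> points G. label G p \<in> marks G} \<and>
     (\<forall>p\<in>points G. label G p \<in> marks G \<longrightarrow> (p \<in> heads G \<longleftrightarrow> arc G p \<notin> heads G))"

definition ribbon_graph :: "('p, 'e) ribbon \<Rightarrow> bool" where
  "ribbon_graph G \<longleftrightarrow> arrow_marked_ribbon_graph G \<and> marks G = {}"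

definition orbits :: "('p \<Rightarrow> 'p) set \<Rightarrow> 'p set \<Rightarrow> 'p set set" where
  "orbits F X = X // {(p, q). \<exists>f\<in>F. q = f p}\<^sup>*"

definition vertex_orbits :: "('p, 'e) ribbon \<Rightarrow> 'p set set" where
  "vertex_orbits G = orbits {arc G, gap G} (points G)"

definition verts :: "('p, 'e) ribbon \<Rightarrow> ('p set + nat) set" where
  "verts G = vertex_orbits G <+> {..<bare G}"

text \<open>The vertices of the underlying abstract graph that an edge joins; just one for a loop.\<close>

definition ends :: "('p, 'e) ribbon \<Rightarrow> 'e \<Rightarrow> ('p set + nat) set" where
  "ends G e = {Inl V | V. V \<in> vertex_orbits G \<and> (\<exists>p\<in>V. label G p = e)}"

definition bipartite :: "('p, 'e) ribbon \<Rightarrow> bool" where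
  "bipartite G \<longleftrightarrow> (\<exists>X Y. X \<union> Y = verts G \<and> X \<inter> Y = {} \<and>
     (\<forall>e\<in>edges G. \<exists>x\<in>X. \<exists>y\<in>Y. ends G e = {x, y}))"


section \<open>Geometric and partial duals\<close>

text \<open>
  A boundary component of \<open>G\<close> runs along gaps, arrows and sides of edge discs. These components
  bound the vertex discs of the dual, which the edge discs therefore meet along their former sides,
  while the arrows stay where they are. A bare vertex disc is replaced by another bare disc.
\<close>

definition dual :: "('p, 'e) ribbon \<Rightarrow> ('p, 'e) ribbon" where
  "dual G = G\<lparr>arc := (\<lambda>p. if label G p \<in> edges G then side G p else arc G p),
              side := (\<lambda>p. if label G p \<in> edges G then arc G p else side G p)\<rparr>"

text \<open>
  An orientation of the boundaries of the edge discs in \<open>B\<close>, given by the set \<open>H\<close> of the heads of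
  the arcs in which these discs meet the vertices. Following the boundary of a disc, every side
  leads from the head of one arc to the tail of the other one.
\<close>

definition boundary_orientation :: "('p, 'e) ribbon \<Rightarrow> 'e set \<Rightarrow> 'p set \<Rightarrow> bool" where
  "boundary_orientation G B H \<longleftrightarrow>
     H \<subseteq> {p \<in> points G. label G p \<in> B} \<and>
     (\<forall>p\<in>points G. label G p \<in> B \<longrightarrow>
        (p \<in> H \<longleftrightarrow> arc G p \<notin> H) \<and> (p \<in> H \<longleftrightarrow> side G p \<notin> H))"

definition arrow_delete :: "('p, 'e) ribbon \<Rightarrow> 'e set \<Rightarrow> 'p set \<Rightarrow> ('p, 'e) ribbon" where
  "arrow_delete G B H =
     G\<lparr>side := (\<lambda>p. if label G p \<in> B then p else side G p),
       edges := edges G - B, marks := marks G \<union> B, heads := heads G \<union> H\<rparr>"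

text \<open>The side of a new edge disc at the head of one arrow leads to the tail of the other arrow.\<close>

definition arrow_add :: "('p, 'e) ribbon \<Rightarrow> 'e set \<Rightarrow> ('p, 'e) ribbon" where
  "arrow_add K B =
     K\<lparr>side := (\<lambda>p. if p \<in> points K \<and> label K p \<in> B
                    then (THE q. q \<in> points K \<and> label K q = label K p \<and> q \<noteq> arc K p \<and>
                                 (q \<in> heads K \<longleftrightarrow> p \<notin> heads K))
                    else side K p),
       edges := edges K \<union> B, marks := marks K - B,
       heads := heads K - {p. label K p \<in> B}\<rparr>"

text \<open>
  The result does not depend on the choice of the orientation; see \<open>partial_dual_eq\<close> below.
\<close>

definition partial_dual :: "('p, 'e) ribbon \<Rightarrow> 'e set \<Rightarrow> ('p, 'e) ribbon" where
  "partial_dual G A =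
     (let B = edges G - A; H = (SOME H. boundary_orientation G B H)
      in arrow_add (dual (arrow_delete G B H)) B)"

lemma arrow_marked_ribbon_graphD:
  assumes "arrow_marked_ribbon_graph G"
  shows "finite (points G)" "finite (edges G)" "edges G \<inter> marks G = {}"
    and "p \<in> points G \<Longrightarrow>
      arc G p \<in> points G \<and> arc G p \<noteq> p \<and> arc G (arc G p) = p \<and> label G (arc G p) = label G p"
    and "p \<in> points G \<Longrightarrow> gap G p \<in> points G \<and> gap G p \<noteq> p \<and> gap G (gap G p) = p"
    and "p \<in> points G \<Longrightarrow> label G p \<in> edges G \<union> marks G"
    and "e \<in> edges G \<Longrightarrow> card {p \<in> points G. label G p = e} = 4"
    and "p \<in> points G \<Longrightarrow> label G p \<in> edges G \<Longrightarrow>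
      side G p \<in> points G \<and> side G p \<noteq> p \<and> side G p \<noteq> arc G p \<and> side G (side G p) = p \<and>
      side G (arc G p) = arc G (side G p) \<and> label G (side G p) = label G p"
    and "heads G \<subseteq> {p \<in> points G. label G p \<in> marks G}"
  using assms unfolding arrow_marked_ribbon_graph_def by (elim conjE, blast)+

lemma edge_points:
  assumes G: "arrow_marked_ribbon_graph G" and p: "p \<in> points G" "label G p \<in> edges G"
  shows "{q \<in> points G. label G q = label G p} = {p, arc G p, side G p, arc G (side G p)}"
proof -
  let ?P = "{q \<in> points G. label G q = label G p}"
  let ?Q = "{p, arc G p, side G p, arc G (side G p)}"
  have s: "side G p \<in> points G" "side G p \<noteq> p" "side G p \<noteq> arc G p" "label G (side G p) = label G p"
    using arrow_marked_ribbon_graphD(8)[OF G p] by auto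
  have a: "\<And>q. q \<in> points G \<Longrightarrow>
      arc G q \<in> points G \<and> arc G q \<noteq> q \<and> arc G (arc G q) = q \<and> label G (arc G q) = label G q"
    using arrow_marked_ribbon_graphD(4)[OF G] .
  have fin: "finite ?P" using arrow_marked_ribbon_graphD(1)[OF G] by auto
  have "card ?P = 4"
    using arrow_marked_ribbon_graphD(7)[OF G p(2)] .
  moreover have "card ?Q = 4"
  proof -
    have "arc G (side G p) \<noteq> p" using a[OF s(1)] s(3) by metis
    moreover have "arc G (side G p) \<noteq> arc G p" using a[OF s(1)] a[OF p(1)] s(2) by metis
    moreover have "arc G (side G p) \<noteq> side G p" "arc G p \<noteq> p" using a[OF s(1)] a[OF p(1)] by auto
    ultimately have "distinct [p, arc G p, side G p, arc G (side G p)]"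
      using s(2,3) by (simp add: eq_commute)
    from distinct_card[OF this] show ?thesis by simp
  qed
  moreover have "?Q \<subseteq> ?P" using s a[OF p(1)] a[OF s(1)] p by simp
  ultimately show ?thesis using card_subset_eq[OF fin, of ?Q] by simp
qed

lemma ex_boundary_orientation:
  assumes G: "ribbon_graph G" and B: "B \<subseteq> edges G"
  shows "\<exists>H. boundary_orientation G B H"
proof -
  have am: "arrow_marked_ribbon_graph G" using G unfolding ribbon_graph_def by auto
  define r where "r e = (SOME p. p \<in> points G \<and> label G p = e)" for e
  have r: "r e \<in> points G \<and> label G (r e) = e" if "e \<in> B" for e
  proof -
    have "card {p \<in> points G. label G p = e} = 4"
      using arrow_marked_ribbon_graphD(7)[OF am] that B by blast
    then have "{p \<in> points G. label G p = e} \<noteq> {}" by (metis card.empty zero_neq_numeral)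
    then have "\<exists>p. p \<in> points G \<and> label G p = e" by blast
    then show ?thesis unfolding r_def by (rule someI_ex)
  qed
  define H where "H = {p \<in> points G. label G p \<in> B \<and>
    (p = r (label G p) \<or> p = arc G (side G (r (label G p))))}"
  have "(p \<in> H \<longleftrightarrow> arc G p \<notin> H) \<and> (p \<in> H \<longleftrightarrow> side G p \<notin> H)"
    if p: "p \<in> points G" "label G p \<in> B" for p
  proof -
    have ax: "\<And>p. p \<in> points G \<Longrightarrow> label G p \<in> B \<Longrightarrow>
       arc G p \<in> points G \<and> arc G p \<noteq> p \<and> arc G (arc G p) = p \<and> label G (arc G p) = label G p \<and>
       side G p \<in> points G \<and> side G p \<noteq> p \<and> side G p \<noteq> arc G p \<and> side G (side G p) = p \<and>
       side G (arc G p) = arc G (side G p) \<and> label G (side G p) = label G p"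
      using arrow_marked_ribbon_graphD(4,8)[OF am] B by blast
    define r0 where "r0 = r (label G p)"
    have rr: "r0 \<in> points G" "label G r0 = label G p" using r[OF p(2)] by (auto simp: r0_def)
    have pQ: "p \<in> {r0, arc G r0, side G r0, arc G (side G r0)}"
      using edge_points[OF am rr(1)] p rr B by auto
    have A1: "arc G r0 \<in> points G" "arc G r0 \<noteq> r0" "arc G (arc G r0) = r0"
      "side G r0 \<in> points G" "side G r0 \<noteq> r0" "side G r0 \<noteq> arc G r0" "side G (side G r0) = r0"
      "side G (arc G r0) = arc G (side G r0)" "label G (side G r0) = label G p"
      using ax[OF rr(1)] p rr by auto
    have A2: "arc G (side G r0) \<noteq> side G r0" "arc G (arc G (side G r0)) = side G r0"
      "side G (arc G (side G r0)) = arc G r0"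
      using ax[OF A1(4)] A1 p by auto
    have A3: "arc G (side G r0) \<noteq> r0" "arc G (side G r0) \<noteq> arc G r0"
      using A1 A2(2) by force+
    have m: "p \<in> H \<longleftrightarrow> p = r0 \<or> p = arc G (side G r0)"
      "arc G p \<in> H \<longleftrightarrow> arc G p = r0 \<or> arc G p = arc G (side G r0)"
      "side G p \<in> H \<longleftrightarrow> side G p = r0 \<or> side G p = arc G (side G r0)"
      using ax[OF p] p unfolding H_def r0_def by auto
    from pQ consider "p = r0" | "p = arc G r0" | "p = side G r0" | "p = arc G (side G r0)" by blast
    then show ?thesis
    proof cases
      case 1
      with m A1 A2 A3 show ?thesis by metis
    next
      case 2
      with m A1 A2 A3 show ?thesis by metis
    next
      case 3
      with m A1 A2 A3 show ?thesis by metis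
    next
      case 4
      with m A1 A2 A3 show ?thesis by metis
    qed
  qed
  moreover have "H \<subseteq> {p \<in> points G. label G p \<in> B}" unfolding H_def by blast
  ultimately have "boundary_orientation G B H"
    unfolding boundary_orientation_def by blast
  then show ?thesis ..
qed

lemma partial_dual_choice:
  assumes G: "ribbon_graph G" and A: "A \<subseteq> edges G" and B: "B = edges G - A"
    and H: "boundary_orientation G B H"
  shows "arrow_add (dual (arrow_delete G B H)) B =
    G\<lparr>arc := (\<lambda>p. if label G p \<in> A then side G p else arc G p),
      side := (\<lambda>p. if label G p \<in> A then arc G p
                   else if p \<notin> points G \<and> label G p \<in> B then p else side G p)\<rparr>"
proof -
  have am: "arrow_marked_ribbon_graph G" and mk: "marks G = {}"
    using G unfolding ribbon_graph_def by auto
  have hd: "heads G = {}" using arrow_marked_ribbon_graphD(9)[OF am] mk by auto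
  have the: "(THE q. q \<in> points G \<and> label G q = label G p \<and> q \<noteq> arc G p \<and>
      (q \<in> H \<longleftrightarrow> p \<notin> H)) = side G p"
    if p: "p \<in> points G" "label G p \<in> B" for p
  proof -
    have ax: "arc G p \<in> points G" "label G (arc G p) = label G p"
       "side G p \<in> points G" "side G p \<noteq> arc G p" "label G (side G p) = label G p"
      using arrow_marked_ribbon_graphD(4,8)[OF am, of p] p B by auto
    have Q: "{q \<in> points G. label G q = label G p} = {p, arc G p, side G p, arc G (side G p)}"
      using edge_points[OF am] p B by auto
    have h: "p \<in> H \<longleftrightarrow> side G p \<notin> H" "side G p \<in> H \<longleftrightarrow> arc G (side G p) \<notin> H"
      using H p ax unfolding boundary_orientation_def by metis+
    show ?thesis
    proof (rule the_equality)
      fix q assume q: "q \<in> points G \<and> label G q = label G p \<and> q \<noteq> arc G p \<and> (q \<in> H \<longleftrightarrow> p \<notin> H)"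
      then have "q \<in> {p, arc G p, side G p, arc G (side G p)}" using Q by blast
      then show "q = side G p" using q h by blast
    qed (use ax h in blast)
  qed
  have E: "edges G - B = A" "edges G - B \<union> B = edges G" using A B by auto
  have D: "label G p \<in> B \<Longrightarrow> label G p \<notin> A" for p using B by auto
  have "H \<subseteq> {p \<in> points G. label G p \<in> B}"
    using H unfolding boundary_orientation_def by (rule conjunct1)
  then have hs: "H - {p. label G p \<in> B} = {}" by blast
  define K where "K = dual (arrow_delete G B H)"
  have K: "points K = points G" "label K = label G" "edges K = A" "heads K = H" "marks K = B"
    "gap K = gap G" "bare K = bare G"
    "arc K = (\<lambda>p. if label G p \<in> A then side G p else arc G p)"
    "side K = (\<lambda>p. if label G p \<in> A then arc G p else if label G p \<in> B then p else side G p)"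
    using E D hd mk by (auto simp: K_def dual_def arrow_delete_def fun_eq_iff)
  have S: "(if p \<in> points K \<and> label K p \<in> B
       then (THE q. q \<in> points K \<and> label K q = label K p \<and> q \<noteq> arc K p \<and>
                    (q \<in> heads K \<longleftrightarrow> p \<notin> heads K))
       else side K p) =
     (if label G p \<in> A then arc G p
      else if p \<notin> points G \<and> label G p \<in> B then p else side G p)" for p
  proof (cases "p \<in> points G \<and> label G p \<in> B")
    case True
    then have "arc K p = arc G p" "label G p \<notin> A" using D K by auto
    then show ?thesis using True the[of p] K by simp
  next
    case False
    then show ?thesis using K by auto
  qed
  have "edges K \<union> B = edges G" using K A B by auto
  then show ?thesis
    unfolding K_def[symmetric] arrow_add_def S
    by (intro ribbon.equality) (simp_all add: K hs hd mk)
qed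

lemma partial_dual_eq:
  assumes "ribbon_graph G" "A \<subseteq> edges G" "boundary_orientation G (edges G - A) H"
  shows "partial_dual G A = arrow_add (dual (arrow_delete G (edges G - A) H)) (edges G - A)"
proof -
  have "boundary_orientation G (edges G - A) (SOME H. boundary_orientation G (edges G - A) H)"
    using assms(3) by (rule someI)
  then show ?thesis
    unfolding partial_dual_def Let_def
    using partial_dual_choice[OF assms(1,2) refl] assms(3) by simp
qed


section \<open>Plane graphs\<close>

text \<open>
  Capping the boundary components of \<open>G\<close>, which are the vertices of the dual, gives a closed
  surface. By the classification of surfaces it is the sphere if and only if it is connected and
  has Euler characteristic 2.
\<close>

definition components :: "('p, 'e) ribbon \<Rightarrow> ('p set + nat) set" where
  "components G = orbits {arc G, gap G, side G} (points G) <+> {..<bare G}"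

definition euler_characteristic :: "('p, 'e) ribbon \<Rightarrow> int" where
  "euler_characteristic G =
     int (card (verts G)) - int (card (edges G)) + int (card (verts (dual G)))"

definition plane_graph :: "('p, 'e) ribbon \<Rightarrow> bool" where
  "plane_graph G \<longleftrightarrow>
     ribbon_graph G \<and> card (components G) = 1 \<and> euler_characteristic G = 2"


section \<open>Medial graphs and all-crossing directions\<close>

text \<open>
  The medial graph has an edge for every gap \<open>{p, gap G p}\<close> of \<open>G\<close>, that is, for every pair of
  consecutive edges of a face. Its edge-end at the edge \<open>label G p\<close> leaves through \<open>p\<close>; the two end
  points of the arc in which this edge-end meets the vertex disc are \<open>(p, True)\<close>, facing the vertex
  of \<open>G\<close> at \<open>p\<close>, and \<open>(p, False)\<close>, facing the face of \<open>G\<close> at \<open>p\<close>. Edge-ends bounding a common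
  corner at a medial vertex lie across an arc (same vertex of \<open>G\<close>) or a side (same face of \<open>G\<close>).
  The medial graph of a plane graph without edges is empty.
\<close>

definition medial :: "('p, 'e) ribbon \<Rightarrow> ('p \<times> bool, 'p set) ribbon" where
  "medial G =
     \<lparr>points = points G \<times> UNIV,
      arc = (\<lambda>(p, b). (p, \<not> b)),
      gap = (\<lambda>(p, b). (if b then arc G p else side G p, b)),
      side = (\<lambda>(p, b). (gap G p, b)),
      label = (\<lambda>(p, b). {p, gap G p}),
      edges = (\<lambda>p. {p, gap G p}) ` points G,
      marks = {}, heads = {}, bare = 0\<rparr>"

definition medial_vertex :: "('p, 'e) ribbon \<Rightarrow> 'e \<Rightarrow> ('p \<times> bool) set" where
  "medial_vertex G e = {p \<in> points G. label G p = e} \<times> UNIV"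

text \<open>The faces of \<open>medial G\<close>, as sets of points, that correspond to the vertices of \<open>G\<close>.\<close>

definition black_faces :: "('p, 'e) ribbon \<Rightarrow> ('p \<times> bool) set set" where
  "black_faces G = (\<lambda>V. V \<times> {True}) ` vertex_orbits G"

definition edge_end :: "('p, 'e) ribbon \<Rightarrow> 'p \<Rightarrow> 'p set" where
  "edge_end M p = {p, arc M p}"

text \<open>
  A direction of the edges is given by the set \<open>D\<close> of those edge-ends that are heads. The two ends
  of the edge at \<open>p\<close> are \<open>edge_end M p\<close> and \<open>edge_end M (side M p)\<close>.
\<close>

definition direction :: "('p, 'e) ribbon \<Rightarrow> 'p set set \<Rightarrow> bool" where
  "direction M D \<longleftrightarrow>
     D \<subseteq> edge_end M ` points M \<and>
     (\<forall>p\<in>points M. edge_end M p \<in> D \<longleftrightarrow> edge_end M (side M p) \<notin> D)"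

text \<open>Moving on to the next edge-end around the vertex.\<close>

definition next_end :: "('p, 'e) ribbon \<Rightarrow> 'p \<Rightarrow> 'p" where
  "next_end M p = arc M (gap M p)"

definition all_crossing_direction :: "('p, 'e) ribbon \<Rightarrow> 'p set set \<Rightarrow> bool" where
  "all_crossing_direction M D \<longleftrightarrow> direction M D \<and>
     (\<forall>W\<in>vertex_orbits M. \<exists>p\<in>W.
        edge_end M p \<in> D \<and>
        edge_end M (next_end M p) \<in> D \<and>
        edge_end M (next_end M (next_end M p)) \<notin> D \<and>
        edge_end M (next_end M (next_end M (next_end M p))) \<notin> D)"

text \<open>The corner at the gap \<open>{p, gap M p}\<close> is bounded by the edge-ends at these two points.\<close>

definition c_vertex :: "('p, 'e) ribbon \<Rightarrow> ('p \<times> bool) set set \<Rightarrow> ('p \<times> bool) set \<Rightarrow> bool" where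
  "c_vertex G D W \<longleftrightarrow>
     (\<forall>p \<in> W \<inter> \<Union>(black_faces G).
        edge_end (medial G) p \<in> D \<longleftrightarrow> edge_end (medial G) (gap (medial G) p) \<in> D)"

definition c_edges :: "('p, 'e) ribbon \<Rightarrow> ('p \<times> bool) set set \<Rightarrow> 'e set" where
  "c_edges G D = {e \<in> edges G. c_vertex G D (medial_vertex G e)}"

lemma ribbon_graph_medial:
  assumes "ribbon_graph G"
  shows "ribbon_graph (medial G)"
proof -
  have am: "arrow_marked_ribbon_graph G" and mk: "marks G = {}"
    using assms unfolding ribbon_graph_def by auto
  note D = arrow_marked_ribbon_graphD[OF am]
  have f: "finite (points G)" by (rule D(1))
  have a: "arc G p \<in> points G \<and> arc G p \<noteq> p \<and> arc G (arc G p) = p" if "p \<in> points G" for p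
    using D(4)[OF that] by simp
  have g: "gap G p \<in> points G \<and> gap G p \<noteq> p \<and> gap G (gap G p) = p" if "p \<in> points G" for p
    using D(5)[OF that] .
  have s: "side G p \<in> points G \<and> side G p \<noteq> p \<and> side G (side G p) = p" if "p \<in> points G" for p
    using D(8)[OF that] D(6)[OF that] mk by simp
  have c: "card {x \<in> points (medial G). label (medial G) x = {p, gap G p}} = 4"
    if p: "p \<in> points G" for p
  proof -
    have "{x \<in> points (medial G). label (medial G) x = {p, gap G p}} = {p, gap G p} \<times> UNIV"
      using p g[OF p] by (auto simp: medial_def doubleton_eq_iff)
    moreover have "card {p, gap G p} = 2" using g[OF p] by auto
    ultimately show ?thesis by (simp add: card_cartesian_product)
  qed
  have lab: "{gap G p, gap G (gap G p)} = {p, gap G p}" if "p \<in> points G" for p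
    using g[OF that] by auto
  show ?thesis
    unfolding ribbon_graph_def arrow_marked_ribbon_graph_def
  proof (intro conjI ballI impI)
    fix x assume x: "x \<in> points (medial G)"
    then obtain p b where p: "x = (p, b)" "p \<in> points G" by (auto simp: medial_def)
    show "arc (medial G) x \<in> points (medial G)" "arc (medial G) x \<noteq> x"
      "arc (medial G) (arc (medial G) x) = x" "label (medial G) (arc (medial G) x) = label (medial G) x"
      using p by (simp_all add: medial_def)
    show "gap (medial G) x \<in> points (medial G)" "gap (medial G) x \<noteq> x"
      "gap (medial G) (gap (medial G) x) = x"
      using p a[OF p(2)] s[OF p(2)] by (simp_all add: medial_def)
    show "label (medial G) x \<in> edges (medial G) \<union> marks (medial G)"
      using p by (simp add: medial_def)
    show "side (medial G) x \<in> points (medial G)" "side (medial G) x \<noteq> x"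
      "side (medial G) x \<noteq> arc (medial G) x" "side (medial G) (side (medial G) x) = x"
      "side (medial G) (arc (medial G) x) = arc (medial G) (side (medial G) x)"
      "label (medial G) (side (medial G) x) = label (medial G) x"
      using p g[OF p(2)] lab[OF p(2)] by (simp_all add: medial_def)
    show "x \<in> heads (medial G) \<longleftrightarrow> arc (medial G) x \<notin> heads (medial G)"
      if "label (medial G) x \<in> marks (medial G)"
      using that by (simp add: medial_def)
  next
    fix e assume "e \<in> edges (medial G) \<union> marks (medial G)"
    then show "card {x \<in> points (medial G). label (medial G) x = e} = 4"
      using c by (auto simp: medial_def)
  qed (use f in \<open>simp_all add: medial_def\<close>)
qed

lemma orbit_eq:
  assumes x: "x \<in> W" and cl: "\<And>f y. f \<in> F \<Longrightarrow> y \<in> W \<Longrightarrow> f y \<in> W"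
    and conn: "\<And>y. y \<in> W \<Longrightarrow> (x, y) \<in> {(p, q). \<exists>f\<in>F. q = f p}\<^sup>*"
  shows "{(p, q). \<exists>f\<in>F. q = f p}\<^sup>* `` {x} = W"
proof -
  have "y \<in> W" if "(x, y) \<in> {(p, q). \<exists>f\<in>F. q = f p}\<^sup>*" for y
    using that by induction (use x cl in auto)
  then show ?thesis using conn by auto
qed

lemma vertex_orbits_medial:
  assumes G: "ribbon_graph G"
  shows "vertex_orbits (medial G) = medial_vertex G ` edges G"
proof -
  have am: "arrow_marked_ribbon_graph G" and mk: "marks G = {}"
    using G unfolding ribbon_graph_def by auto
  have lab: "\<And>p. p \<in> points G \<Longrightarrow> label G p \<in> edges G"
    using arrow_marked_ribbon_graphD(6)[OF am] mk by auto
  have a: "arc G p \<in> points G \<and> label G (arc G p) = label G p" if "p \<in> points G" for p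
    using arrow_marked_ribbon_graphD(4)[OF am that] by simp
  have s: "side G p \<in> points G \<and> label G (side G p) = label G p" if "p \<in> points G" for p
    using arrow_marked_ribbon_graphD(8)[OF am that lab[OF that]] by simp
  let ?R = "{(p, q). \<exists>f\<in>{arc (medial G), gap (medial G)}. q = f p}"
  have orb: "?R\<^sup>* `` {(p, b)} = medial_vertex G (label G p)" if p: "p \<in> points G" for p b
  proof (rule orbit_eq)
    show "(p, b) \<in> medial_vertex G (label G p)" using p by (auto simp: medial_vertex_def)
    show "f y \<in> medial_vertex G (label G p)"
      if "f \<in> {arc (medial G), gap (medial G)}" "y \<in> medial_vertex G (label G p)" for f y
      using that a s by (auto simp: medial_vertex_def medial_def)
    have tog: "(x, (q, c')) \<in> ?R\<^sup>*" if x: "(x, (q, c)) \<in> ?R\<^sup>*" for x q c c'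
    proof (cases "c' = c")
      case False
      then have "((q, c), (q, c')) \<in> ?R" by (auto simp: medial_def)
      with x show ?thesis by (rule rtrancl.rtrancl_into_rtrancl)
    qed (use x in auto)
    have arcs: "(x, (arc G q, c)) \<in> ?R\<^sup>*" if x: "(x, (q, c)) \<in> ?R\<^sup>*" for x q c
    proof -
      have "((q, True), (arc G q, True)) \<in> ?R" by (auto simp: medial_def)
      with tog[OF x] have "(x, (arc G q, True)) \<in> ?R\<^sup>*" by (rule rtrancl.rtrancl_into_rtrancl)
      then show ?thesis by (rule tog)
    qed
    have sides: "(x, (side G q, c)) \<in> ?R\<^sup>*" if x: "(x, (q, c)) \<in> ?R\<^sup>*" for x q c
    proof -
      have "((q, False), (side G q, False)) \<in> ?R" by (auto simp: medial_def)
      with tog[OF x] have "(x, (side G q, False)) \<in> ?R\<^sup>*" by (rule rtrancl.rtrancl_into_rtrancl)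
      then show ?thesis by (rule tog)
    qed
    fix y assume "y \<in> medial_vertex G (label G p)"
    then obtain q c where y: "y = (q, c)" and q: "q \<in> {q \<in> points G. label G q = label G p}"
      by (auto simp: medial_vertex_def)
    then have "q \<in> {p, arc G p, side G p, arc G (side G p)}"
      using edge_points[OF am p lab[OF p]] by auto
    moreover have "((p, b), (p, c)) \<in> ?R\<^sup>*" using tog by blast
    ultimately show "((p, b), y) \<in> ?R\<^sup>*" unfolding y using arcs sides by blast
  qed
  have ex: "\<exists>p\<in>points G. label G p = e" if "e \<in> edges G" for e
  proof -
    have "card {p \<in> points G. label G p = e} = 4"
      using arrow_marked_ribbon_graphD(7)[OF am that] .
    then have "{p \<in> points G. label G p = e} \<noteq> {}" by (metis card.empty zero_neq_numeral)
    then show ?thesis by auto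
  qed
  have "vertex_orbits (medial G) = (\<lambda>x. ?R\<^sup>* `` {x}) ` (points G \<times> UNIV)"
    by (auto simp: vertex_orbits_def orbits_def quotient_def medial_def)
  also have "\<dots> = medial_vertex G ` label G ` points G"
    using orb by (force simp: image_iff)
  also have "label G ` points G = edges G" using ex lab by auto
  finally show ?thesis .
qed

end

theory Submission
  imports Defs
begin

text \<open>
  Both sides of the equivalence ask for a two-colouring of the end points of the arcs in which the
  edge discs meet the vertices.

  \<^item> \<open>G\<^sup>A\<close> is bipartite if and only if there is a colouring that is constant along gaps and that,
    around an edge disc, is constant along the arcs and changes along the sides, or, for the edges
    in \<open>A\<close>, the other way round (\<open>bipartite_partial_dual_iff\<close>): give each point the colour class
    of its vertex.

  \<^item> A point is also an edge-end of the medial graph. Colour it by whether that end is a head. The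
    colour then changes along every gap, because an edge has one head and one tail. The pattern
    (head, head, tail, tail) means that around an edge disc of \<open>G\<close> the colour is constant along
    the arcs and changes along the sides, or the other way round. The black corners are the arcs, so
    the first case describes a \<open>c\<close>-edge (\<open>all_crossing_c_edges_iff\<close>).

  The two conditions differ by reversing the behaviour along every gap, arc and side at once. Hence
  the exclusive or with a function \<open>u\<close> that changes along all gaps, arcs and sides turns the
  solutions of one into those of the other. Such a \<open>u\<close> is an orientation of the surface, so it
  remains to see that the sphere, which is given here as a connected surface of Euler characteristic
  2, is orientable (\<open>plane_graph_orientable\<close>).

  For this the edges are inserted one at a time into the ribbon subgraph without edges. Let \<open>v\<close> be
  the number of vertices, and let \<open>f\<close> and \<open>k\<close> be the numbers of boundary components and of connected
  components of the subgraph with edge set \<open>S\<close>. By induction \<open>v + f \<le> \<bar>S\<bar> + 2 * k\<close>, and equality makes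
  the subgraph orientable (\<open>euler_bound\<close>). An edge that joins two components merges two boundary
  components, which preserves the difference of the two sides, and an orientation extends after
  reversing it on one of the components if necessary. An edge within a component
  increases \<open>f\<close> by at most 1. If it does increase \<open>f\<close>, then it is attached to a single boundary
  component without a twist, and the old orientation remains valid. For the plane graph itself
  the assumption says that equality holds.
\<close>


section \<open>Counting connected components\<close>

definition linked :: "('a \<times> 'a) set \<Rightarrow> ('a \<times> 'a) set" where
  "linked R = (R \<union> R\<inverse>)\<^sup>*"

definition ncomps :: "'a set \<Rightarrow> ('a \<times> 'a) set \<Rightarrow> nat" where
  "ncomps X R = card (X // linked R)"

lemma linked_refl [simp]: "(p, p) \<in> linked R"
  by (simp add: linked_def)

lemma linked_sym: "(p, q) \<in> linked R \<Longrightarrow> (q, p) \<in> linked R"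
  unfolding linked_def by (metis sym_Un_converse sym_rtrancl symD)

lemma linked_trans: "(p, q) \<in> linked R \<Longrightarrow> (q, r) \<in> linked R \<Longrightarrow> (p, r) \<in> linked R"
  unfolding linked_def by (rule rtrancl_trans)

lemma equiv_linked: "equiv UNIV (linked R)"
  by (auto intro!: equivI refl_onI symI transI intro: linked_sym linked_trans)

lemma linked_step: "(p, q) \<in> R \<Longrightarrow> (p, q) \<in> linked R"
  unfolding linked_def by auto

lemma subset_linked: "R \<subseteq> R' \<Longrightarrow> R \<subseteq> linked R'"
  unfolding linked_def by auto

lemma linked_mono: "R \<subseteq> linked R' \<Longrightarrow> linked R \<subseteq> linked R'"
proof -
  assume a: "R \<subseteq> linked R'"
  then have "R \<union> R\<inverse> \<subseteq> linked R'" using linked_sym by fastforce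
  then have "(R \<union> R\<inverse>)\<^sup>* \<subseteq> (linked R')\<^sup>*" by (rule rtrancl_mono)
  then show ?thesis by (simp add: linked_def)
qed

lemma linked_insert:
  "(p, q) \<in> linked (insert (x, z) R) \<longleftrightarrow>
    (p, q) \<in> linked R \<or> (p, x) \<in> linked R \<and> (z, q) \<in> linked R \<or>
    (p, z) \<in> linked R \<and> (x, q) \<in> linked R"
proof -
  have eq: "insert (x, z) R \<union> (insert (x, z) R)\<inverse> = insert (x, z) (insert (z, x) (R \<union> R\<inverse>))"
    by auto
  show ?thesis
    unfolding linked_def eq rtrancl_insert Un_iff mem_Collect_eq prod.case
    by (blast intro: rtrancl_trans)
qed

lemma ncomps_insert_linked:
  assumes "(x, z) \<in> linked R"
  shows "ncomps X (insert (x, z) R) = ncomps X R"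
proof -
  have "insert (x, z) R \<subseteq> linked R" using assms linked_step by auto
  then have "linked (insert (x, z) R) \<subseteq> linked R" by (rule linked_mono)
  then have "linked (insert (x, z) R) = linked R" by (auto simp: linked_insert)
  then show ?thesis by (simp add: ncomps_def)
qed

lemma ncomps_insert_not_linked:
  assumes X: "finite X" "x \<in> X" "z \<in> X" and n: "(x, z) \<notin> linked R"
  shows "Suc (ncomps X (insert (x, z) R)) = ncomps X R"
proof -
  let ?L = "linked R" and ?L' = "linked (insert (x, z) R)"
  let ?x = "?L `` {x}" and ?z = "?L `` {z}"
  have cls: "?L `` {p} = ?L `` {q} \<longleftrightarrow> (p, q) \<in> ?L" for p q
    by (rule eq_equiv_class_iff[OF equiv_linked UNIV_I UNIV_I])
  have new: "?L' `` {p} = (if (x, p) \<in> ?L \<or> (z, p) \<in> ?L then ?x \<union> ?z else ?L `` {p})" for p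
  proof (rule set_eqI)
    fix q
    show "q \<in> ?L' `` {p} \<longleftrightarrow> q \<in> (if (x, p) \<in> ?L \<or> (z, p) \<in> ?L then ?x \<union> ?z else ?L `` {p})"
      unfolding Image_singleton_iff linked_insert
      by (cases "(x, p) \<in> ?L \<or> (z, p) \<in> ?L") (auto dest: linked_sym linked_trans)
  qed
  have q: "X // S = (\<lambda>p. S `` {p}) ` X" for S :: "('a \<times> 'a) set"
    by (auto simp: quotient_def)
  have eq: "X // ?L' = insert (?x \<union> ?z) (X // ?L - {?x, ?z})"
  proof -
    have gen: "(\<lambda>p. if P p then U else f p) ` X = insert U (f ` X - T)"
      if "P x" "\<And>p. f p \<in> T \<longleftrightarrow> P p" for P and f :: "'a \<Rightarrow> 'a set" and U T
      using that X(2) by auto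
    show ?thesis unfolding q new
    proof (rule gen)
      show "?L `` {p} \<in> {?x, ?z} \<longleftrightarrow> (x, p) \<in> ?L \<or> (z, p) \<in> ?L" for p
        using cls[of x p] cls[of z p] by (simp add: eq_commute)
    qed simp
  qed
  have "?x \<union> ?z \<notin> X // ?L - {?x, ?z}"
  proof
    assume "?x \<union> ?z \<in> X // ?L - {?x, ?z}"
    then obtain p where p: "?x \<union> ?z = ?L `` {p}" "?L `` {p} \<noteq> ?x" unfolding q by blast
    from p(1) have "x \<in> ?L `` {p}" by (metis Image_singleton_iff UnI1 linked_refl)
    then have "?L `` {p} = ?x" using cls[of p x] by simp
    then show False using p(2) by contradiction
  qed
  moreover have "finite (X // ?L)" "?x \<in> X // ?L" "?z \<in> X // ?L" unfolding q using X by auto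
  moreover have "?x \<noteq> ?z" using n cls[of x z] by simp
  moreover from calculation have "card {?x, ?z} \<le> card (X // ?L)" by (intro card_mono) auto
  ultimately show ?thesis
    unfolding ncomps_def eq by (simp add: card_Diff_subset)
qed

lemma ncomps_insert:
  assumes "finite X" "x \<in> X" "z \<in> X"
  shows "Suc (ncomps X (insert (x, z) R)) = ncomps X R + of_bool ((x, z) \<in> linked R)"
  using ncomps_insert_linked[of x z R X] ncomps_insert_not_linked[OF assms] by auto

text \<open>
  In the application, \<open>x\<close>, \<open>y\<close>, \<open>w\<close>, \<open>z\<close> are the corners of an edge disc in cyclic order. Inserting the
  disc replaces the two pieces of boundary \<open>x y\<close> and \<open>z w\<close> by its sides \<open>x z\<close> and \<open>y w\<close>. Two insertions
  reduce the number of components by at most 2, so the counts before and after are compared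
  through \<open>R\<close>, where both pairs are missing. The additional clause on equality finds a side of the
  disc that closes up a strand of \<open>R\<close> containing no further corner.
\<close>

lemma rewire_increase:
  assumes X: "finite X" "x \<in> X" "y \<in> X" "z \<in> X" "w \<in> X"
  shows "ncomps X (insert (y, w) (insert (x, z) R)) \<le> Suc (ncomps X (insert (z, w) (insert (x, y) R)))"
    and "ncomps X (insert (y, w) (insert (x, z) R)) = Suc (ncomps X (insert (z, w) (insert (x, y) R))) \<Longrightarrow>
      (x, z) \<in> linked R \<and> (x, y) \<notin> linked R \<and> (x, w) \<notin> linked R \<or>
      (y, w) \<in> linked R \<and> (y, x) \<notin> linked R \<and> (y, z) \<notin> linked R"
proof -
  note s = linked_sym[of _ _ R] and t = linked_trans[of _ _ R]
  have A: "ncomps X (insert (z, w) (insert (x, y) R)) + 2 =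
     ncomps X R + of_bool ((x, y) \<in> linked R) + of_bool ((z, w) \<in> linked (insert (x, y) R))"
    using ncomps_insert[OF X(1,2,3), of R] ncomps_insert[OF X(1,4,5), of "insert (x, y) R"]
    by linarith
  have B: "ncomps X (insert (y, w) (insert (x, z) R)) + 2 =
     ncomps X R + of_bool ((x, z) \<in> linked R) + of_bool ((y, w) \<in> linked (insert (x, z) R))"
    using ncomps_insert[OF X(1,2,4), of R] ncomps_insert[OF X(1,3,5), of "insert (x, z) R"]
    by linarith
  have D: "(x, z) \<in> linked R \<Longrightarrow> (y, w) \<in> linked (insert (x, z) R) \<Longrightarrow>
       (x, y) \<notin> linked R \<Longrightarrow> (z, w) \<in> linked (insert (x, y) R)"
    unfolding linked_insert by (metis s t)
  show "ncomps X (insert (y, w) (insert (x, z) R)) \<le> Suc (ncomps X (insert (z, w) (insert (x, y) R)))"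
    using A B D by (auto simp: of_bool_def split: if_splits)
  assume "ncomps X (insert (y, w) (insert (x, z) R)) = Suc (ncomps X (insert (z, w) (insert (x, y) R)))"
  then have c: "(of_bool ((x, z) \<in> linked R) + of_bool ((y, w) \<in> linked (insert (x, z) R)) :: nat) =
    Suc (of_bool ((x, y) \<in> linked R) + of_bool ((z, w) \<in> linked (insert (x, y) R)))"
    using A B by linarith
  then have nxy: "(x, y) \<notin> linked R"
    by (auto simp: of_bool_def linked_insert split: if_splits intro: s t)
  consider "(x, z) \<in> linked R" | "(x, z) \<notin> linked R" "(y, w) \<in> linked (insert (x, z) R)"
     "(z, w) \<notin> linked (insert (x, y) R)"
    using c by (auto simp: of_bool_def split: if_splits)
  then show "(x, z) \<in> linked R \<and> (x, y) \<notin> linked R \<and> (x, w) \<notin> linked R \<or>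
      (y, w) \<in> linked R \<and> (y, x) \<notin> linked R \<and> (y, z) \<notin> linked R"
  proof cases
    case 1
    have "(x, w) \<notin> linked R"
    proof
      assume xw: "(x, w) \<in> linked R"
      then have "(z, w) \<in> linked R" using 1 s t by meson
      then have "(z, w) \<in> linked (insert (x, y) R)" by (simp add: linked_insert)
      then have "(y, w) \<in> linked (insert (x, z) R)"
        using c nxy by (auto simp: of_bool_def split: if_splits)
      then have "(x, y) \<in> linked R" using 1 xw unfolding linked_insert by (meson s t)
      then show False using nxy by simp
    qed
    then show ?thesis using 1 nxy by blast
  next
    case 2
    then have "(y, w) \<in> linked R" "(y, z) \<notin> linked R"
      using nxy unfolding linked_insert by (metis s t)+
    then show ?thesis using nxy s by blast
  qed
qed

text \<open>
  The edge disc joins the closed curve through \<open>x\<close>, \<open>y\<close> to the different closed curve through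
  \<open>z\<close>, \<open>w\<close>.
\<close>

lemma rewire_decrease:
  assumes X: "finite X" "x \<in> X" "z \<in> X"
    and xy: "(x, y) \<in> linked R" and zw: "(z, w) \<in> linked R" and xz: "(x, z) \<notin> linked R"
  shows "Suc (ncomps X (insert (y, w) (insert (x, z) R))) = ncomps X (insert (z, w) (insert (x, y) R))"
proof -
  have "(y, w) \<in> linked (insert (x, z) R)" "(z, w) \<in> linked (insert (x, y) R)"
    using linked_sym[OF xy] linked_sym[OF zw] xy zw by (auto simp: linked_insert)
  then show ?thesis
    using ncomps_insert_linked ncomps_insert_not_linked[OF X xz] ncomps_insert_linked[OF xy]
    by metis
qed


section \<open>Alternating curves\<close>

definition pairing :: "'a set \<Rightarrow> ('a \<Rightarrow> 'a) \<Rightarrow> bool" where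
  "pairing X f \<longleftrightarrow> (\<forall>p\<in>X. f p \<in> X \<and> f p \<noteq> p \<and> f (f p) = p)"

lemma pairing_even_card:
  assumes "finite X" "pairing X f"
  shows "even (card X)"
  using assms
proof (induction X rule: finite_psubset_induct)
  case (psubset X)
  show ?case
  proof (cases "X = {}")
    case False
    then obtain p where p: "p \<in> X" by auto
    let ?Y = "X - {p, f p}"
    have f: "f p \<in> X" "f p \<noteq> p" "f (f p) = p" using psubset.prems p by (auto simp: pairing_def)
    have "pairing ?Y f" using psubset.prems f unfolding pairing_def by (metis Diff_iff insert_iff singletonD)
    then have "even (card ?Y)" using psubset.IH[of ?Y] p by auto
    moreover have "card X = card ?Y + card {p, f p}"
      using p f psubset.hyps card_Diff_subset[of "{p, f p}" X] card_mono[of X "{p, f p}"] by auto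
    ultimately show ?thesis using f by simp
  qed simp
qed

lemma pairing_sum_zero:
  fixes h :: "'a \<Rightarrow> int"
  assumes "pairing X f" and "\<And>p. p \<in> X \<Longrightarrow> h (f p) = - h p"
  shows "sum h X = 0"
proof -
  have "sum h X = (\<Sum>p\<in>X. - h p)"
    using assms by (intro sum.reindex_bij_witness[of X f f]) (auto simp: pairing_def)
  then show ?thesis by (simp add: sum_negf)
qed

text \<open>
  The curves that run alternately along \<open>a\<close> and \<open>g\<close> are even cycles. Two points matched by \<open>g\<close> are
  removed from such a cycle, their outer neighbours, if there are any, are matched instead, and a
  colouring of the shorter cycle extends to the two points.
\<close>

lemma ex_alternating:
  assumes "finite X" "pairing X a" "pairing X g"
  shows "\<exists>c :: 'a \<Rightarrow> bool. \<forall>p\<in>X. c (a p) \<noteq> c p \<and> c (g p) \<noteq> c p"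
  using assms
proof (induction X arbitrary: a rule: finite_psubset_induct)
  case (psubset X)
  show ?case
  proof (cases "X = {}")
    case False
    then obtain p where p: "p \<in> X" by auto
    define q where "q = g p"
    let ?Y = "X - {p, q}"
    have q: "q \<in> X" "q \<noteq> p" "g q = p" using psubset.prems p by (auto simp: pairing_def q_def)
    have a: "\<And>r. r \<in> X \<Longrightarrow> a r \<in> X \<and> a r \<noteq> r \<and> a (a r) = r"
      and g: "\<And>r. r \<in> X \<Longrightarrow> g r \<in> X \<and> g r \<noteq> r \<and> g (g r) = r"
      using psubset.prems by (auto simp: pairing_def)
    define a' where "a' r = (if a r = p then a q else if a r = q then a p else a r)" for r
    have gY: "pairing ?Y g"
      unfolding pairing_def using g q q_def by (metis Diff_iff insert_iff singletonD)
    have aY: "pairing ?Y a'"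
      unfolding pairing_def
    proof
      fix r assume r: "r \<in> ?Y"
      then have "r \<noteq> p" "r \<noteq> q" "r \<in> X" by auto
      then show "a' r \<in> ?Y \<and> a' r \<noteq> r \<and> a' (a' r) = r"
        unfolding a'_def using a[OF \<open>r \<in> X\<close>] a[OF p] a[OF q(1)] q(2)
        by (smt (verit) Diff_iff insert_iff singletonD)
    qed
    obtain c :: "'a \<Rightarrow> bool" where c: "\<And>r. r \<in> ?Y \<Longrightarrow> c (a' r) \<noteq> c r \<and> c (g r) \<noteq> c r"
      using psubset.IH[of ?Y a'] p gY aY by blast
    define d where "d = (if a p = q then c(p := True, q := False)
       else c(p := \<not> c (a p), q := c (a p)))"
    have gr: "g r \<in> ?Y" if "r \<in> ?Y" for r using gY that by (auto simp: pairing_def)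
    have "d (a r) \<noteq> d r \<and> d (g r) \<noteq> d r" if r: "r \<in> X" for r
    proof (cases "r \<in> ?Y")
      case True
      then have rr: "r \<noteq> p" "r \<noteq> q" by auto
      have gg: "g r \<noteq> p" "g r \<noteq> q" using gr[OF True] by auto
      have cc: "c (a' r) \<noteq> c r" "c (g r) \<noteq> c r" using c[OF True] by auto
      have dg: "d (g r) \<noteq> d r" using rr gg cc by (simp add: d_def)
      have "d (a r) \<noteq> d r"
      proof (cases "a p = q")
        case True
        then have "a q = p" using a[OF p] by simp
        then have "a r \<noteq> p" "a r \<noteq> q" using a[OF r] rr True by metis+
        then show ?thesis using rr cc True by (simp add: d_def a'_def)
      next
        case False
        have "a p \<in> ?Y" using False a[OF p] by auto
        have z: "c (a q) \<noteq> c (a p)"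
          using c[OF \<open>a p \<in> ?Y\<close>] a[OF p] by (simp add: a'_def)
        show ?thesis
        proof (cases "a r = p \<or> a r = q")
          case True
          then have "r = a p \<and> a r = p \<or> r = a q \<and> a r = q" using a[OF r] by metis
          then show ?thesis using z rr False q(2) by (auto simp: d_def)
        next
          case f: False
          then show ?thesis using rr cc False by (simp add: d_def a'_def)
        qed
      qed
      with dg show ?thesis by simp
    next
      case False
      then consider "r = p" | "r = q" using r by auto
      then have dg: "d (g r) \<noteq> d r" using q q_def by cases (auto simp: d_def)
      have "d (a r) \<noteq> d r"
      proof (cases "a p = q")
        case True
        then have "a q = p" using a[OF p] by simp
        then show ?thesis using \<open>r \<notin> ?Y\<close> r True q(2) by (auto simp: d_def)
      next
        case F: False
        have Y: "a p \<in> ?Y" using F a[OF p] by auto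
        have aq: "a q \<noteq> p" "a q \<noteq> q" using F a[OF q(1)] by auto
        have z: "c (a q) \<noteq> c (a p)"
          using c[OF Y] a[OF p] by (simp add: a'_def)
        show ?thesis using False r F z aq Y q(2) by (auto simp: d_def)
      qed
      with dg show ?thesis by simp
    qed
    then show ?thesis by blast
  qed simp
qed

lemma linked_closed:
  assumes "(p, q) \<in> linked R" "p \<in> C" and "\<And>r s. (r, s) \<in> R \<Longrightarrow> r \<in> C \<longleftrightarrow> s \<in> C"
  shows "q \<in> C"
  using assms(1) unfolding linked_def by induction (use assms(2,3) in auto)

text \<open>
  With \<open>Q\<close> empty these are the closed curves that alternate between \<open>g\<close> and \<open>b\<close>. In general they
  are cut open at the points of \<open>Q\<close>.
\<close>

definition strands :: "'a set \<Rightarrow> ('a \<Rightarrow> 'a) \<Rightarrow> 'a set \<Rightarrow> ('a \<Rightarrow> 'a) \<Rightarrow> ('a \<times> 'a) set" where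
  "strands X g Q b = {(p, g p) |p. p \<in> X} \<union> {(p, b p) |p. p \<in> X - Q}"

lemma strand_pairings:
  assumes g: "pairing X g" and b: "pairing (X - Q) b" and x: "x \<in> X"
    and C: "C = linked (strands X g Q b) `` {x}"
  shows "C \<subseteq> X" "pairing C g" "pairing (C - Q) b"
proof -
  show X: "C \<subseteq> X"
  proof
    fix p assume "p \<in> C"
    then have "(x, p) \<in> linked (strands X g Q b)" by (simp add: C)
    then show "p \<in> X" using x
      by (rule linked_closed) (use g b in \<open>auto simp: strands_def pairing_def\<close>)
  qed
  have "g p \<in> C" if p: "p \<in> C" for p
  proof -
    have "(p, g p) \<in> strands X g Q b" using X p by (auto simp: strands_def)
    then show ?thesis using p linked_step linked_trans unfolding C by fastforce
  qed
  then show "pairing C g" using g X by (auto simp: pairing_def)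
  have "b p \<in> C - Q" if p: "p \<in> C - Q" for p
  proof -
    have "(p, b p) \<in> strands X g Q b" using X p by (auto simp: strands_def)
    then have "b p \<in> C" using p linked_step linked_trans unfolding C by fastforce
    then show ?thesis using b p X by (auto simp: pairing_def)
  qed
  then show "pairing (C - Q) b" using b X by (auto simp: pairing_def)
qed

text \<open>
  A strand that is cut open has two ends. The component \<open>C\<close> of \<open>x\<close> is perfectly matched by \<open>g\<close> and
  \<open>C - Q\<close> is perfectly matched by \<open>b\<close>, so \<open>C \<inter> Q\<close> has even size.
\<close>

lemma strand_other_end:
  assumes X: "finite X" and g: "pairing X g" and b: "pairing (X - Q) b" and x: "x \<in> X" "x \<in> Q"
  shows "\<exists>q\<in>Q. q \<noteq> x \<and> (x, q) \<in> linked (strands X g Q b)"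
proof -
  define C where "C = linked (strands X g Q b) `` {x}"
  note sp = strand_pairings[OF g b x(1) C_def]
  have fin: "finite C" using sp(1) X finite_subset by blast
  have "even (card C)" "even (card (C - Q))"
    using pairing_even_card[OF fin sp(2)] pairing_even_card[OF _ sp(3)] fin by auto
  moreover have "card C = card (C - Q) + card (C \<inter> Q)"
    using fin by (metis Diff_disjoint Diff_partition Int_Diff_disjoint Int_Diff_Un add.commute card_Un_disjoint finite_Diff finite_Int)
  ultimately have "even (card (C \<inter> Q))" by simp
  then have "C \<inter> Q \<noteq> {x}" by auto
  moreover have "x \<in> C \<inter> Q" using x by (simp add: C_def)
  ultimately show ?thesis unfolding C_def by blast
qed

text \<open>
  The component \<open>C\<close> of \<open>x\<close> is matched by \<open>g\<close> and \<open>C - Q\<close> is matched by \<open>b\<close>, always in pairs of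
  opposite colours. So both colours are equally frequent in \<open>C\<close> and in \<open>C - Q\<close>, and hence among the
  two ends.
\<close>

lemma strand_ends_opposite:
  assumes X: "finite X" and g: "pairing X g" and b: "pairing (X - Q) b" and x: "x \<in> X"
    and C: "linked (strands X g Q b) `` {x} \<inter> Q = {x, z}" "x \<noteq> z"
    and cg: "\<And>p. p \<in> X \<Longrightarrow> (c :: 'a \<Rightarrow> bool) (g p) \<noteq> c p" and cb: "\<And>p. p \<in> X - Q \<Longrightarrow> c (b p) \<noteq> c p"
  shows "c x \<noteq> c z"
proof -
  define C where "C = linked (strands X g Q b) `` {x}"
  note sp = strand_pairings[OF g b x(1) C_def]
  have fin: "finite C" using sp(1) X finite_subset by blast
  define h where "h p = (if c p then 1 else -1 :: int)" for p
  have "sum h C = 0" using sp cg by (intro pairing_sum_zero) (auto simp: h_def subset_iff)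
  moreover have "sum h (C - Q) = 0" 
    using sp cb by (intro pairing_sum_zero) (auto simp: h_def subset_iff)
  moreover have "sum h C = sum h (C \<inter> Q) + sum h (C - Q)" using fin by (rule sum.Int_Diff)
  ultimately have "sum h {x, z} = 0" using C by (simp add: C_def)
  then show ?thesis using C(2) by (auto simp: h_def split: if_splits)
qed


lemma linked_eqI: "R \<subseteq> linked R' \<Longrightarrow> R' \<subseteq> linked R \<Longrightarrow> linked R = linked R'"
  by (intro subset_antisym linked_mono)

lemma linked_strands_unfold:
  assumes "{x, y, z, w} \<subseteq> X" and "b x = y" "b y = x" "b z = w" "b w = z"
  shows "linked (strands X g {} b) =
    linked (insert (z, w) (insert (x, y) (strands X g {x, y, z, w} b)))" (is "_ = linked ?R")
proof (rule linked_eqI)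
  have "(x, y) \<in> linked ?R" "(z, w) \<in> linked ?R" by (auto intro: linked_step)
  then have new: "(p, b p) \<in> linked ?R" if "p \<in> {x, y, z, w}" for p
    using that assms linked_sym by fastforce
  have "(p, b p) \<in> linked ?R" if "p \<in> X" for p
    using new linked_step[of p "b p" ?R] that by (cases "p \<in> {x, y, z, w}") (auto simp: strands_def)
  moreover have "(p, g p) \<in> linked ?R" if "p \<in> X" for p
    using that by (auto simp: strands_def intro: linked_step)
  ultimately show "strands X g {} b \<subseteq> linked ?R" unfolding strands_def[of X g "{}"] by blast
  have "?R \<subseteq> strands X g {} b" using assms by (auto simp: strands_def)
  then show "?R \<subseteq> linked (strands X g {} b)" by (rule subset_linked)
qed

lemma linked_class_invariant: "(p, q) \<in> R \<Longrightarrow> (z, p) \<in> linked R \<longleftrightarrow> (z, q) \<in> linked R"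
  by (metis linked_step linked_sym linked_trans)


section \<open>Euler characteristic and orientability\<close>

lemma ribbon_graph_edge_label:
  assumes "ribbon_graph G" "p \<in> points G"
  shows "label G p \<in> edges G"
  using assms arrow_marked_ribbon_graphD(6) by (fastforce simp: ribbon_graph_def)

lemma ribbon_graph_pairings:
  assumes "ribbon_graph G"
  shows "pairing (points G) (arc G)" "pairing (points G) (gap G)" "pairing (points G) (side G)"
  using assms arrow_marked_ribbon_graphD(4,5,8)[of G] ribbon_graph_edge_label[OF assms]
  by (simp_all add: pairing_def ribbon_graph_def)

lemma ribbon_graph_side:
  assumes "ribbon_graph G" "p \<in> points G"
  shows "label G (arc G p) = label G p" "label G (side G p) = label G p"
    "side G (arc G p) = arc G (side G p)" "side G p \<noteq> arc G p"
  using assms arrow_marked_ribbon_graphD(4,8)[of G] ribbon_graph_edge_label[OF assms]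
  by (simp_all add: ribbon_graph_def)

lemma ribbon_graph_edge_points:
  assumes "ribbon_graph G" "p \<in> points G"
  shows "{q \<in> points G. label G q = label G p} = {p, arc G p, side G p, arc G (side G p)}"
  using assms edge_points[of G p] ribbon_graph_edge_label[OF assms] by (simp add: ribbon_graph_def)

lemma ribbon_graph_edge_nonempty:
  assumes "ribbon_graph G" "e \<in> edges G"
  obtains p where "p \<in> points G" "label G p = e"
proof -
  have "card {p \<in> points G. label G p = e} = 4"
    using assms arrow_marked_ribbon_graphD(7) by (auto simp: ribbon_graph_def)
  then have "{p \<in> points G. label G p = e} \<noteq> {}" by (metis card.empty zero_neq_numeral)
  then show ?thesis using that by auto
qed

text \<open>
  The boundary of the ribbon subgraph with edge set \<open>S\<close>. All points of \<open>G\<close> are kept: where an edge is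
  missing, the boundary follows the arc on the vertex disc. Thus \<open>S = {}\<close> gives the vertices of
  \<open>G\<close>, and \<open>S = edges G\<close> gives the vertices of the dual.
\<close>

definition sub_boundary :: "('p, 'e) ribbon \<Rightarrow> 'e set \<Rightarrow> ('p \<times> 'p) set" where
  "sub_boundary G S =
    strands (points G) (gap G) {} (\<lambda>p. if label G p \<in> S then side G p else arc G p)"

definition sub_surface :: "('p, 'e) ribbon \<Rightarrow> 'e set \<Rightarrow> ('p \<times> 'p) set" where
  "sub_surface G S =
    strands (points G) (gap G) {} (arc G) \<union> {(p, side G p) |p. p \<in> points G \<and> label G p \<in> S}"

text \<open>
  An orientation of the ribbon subgraph with edge set \<open>S\<close>: the colour of a point says whether the
  direction that leads from the point into its arc agrees with the orientation of its vertex disc.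
\<close>

definition alternating_on :: "('p, 'e) ribbon \<Rightarrow> 'e set \<Rightarrow> ('p \<Rightarrow> bool) \<Rightarrow> bool" where
  "alternating_on G S c \<longleftrightarrow> (\<forall>p\<in>points G. c (arc G p) \<noteq> c p \<and> c (gap G p) \<noteq> c p \<and>
     (label G p \<in> S \<longrightarrow> c (side G p) \<noteq> c p))"

lemma linked_sub_surface_insert:
  assumes G: "ribbon_graph G" and x: "x \<in> points G"
  shows "linked (sub_surface G (insert (label G x) S)) =
    linked (insert (arc G x, arc G (side G x)) (insert (x, side G x) (sub_surface G S)))"
    (is "linked ?K' = linked ?R")
proof (rule linked_eqI)
  note a = ribbon_graph_pairings[OF G, unfolded pairing_def]
  note s = ribbon_graph_side[OF G]
  have "(x, side G x) \<in> linked ?R" "(arc G x, arc G (side G x)) \<in> linked ?R"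
    by (auto intro: linked_step)
  moreover have "side G (arc G (side G x)) = arc G x"
    using s(3)[of "side G x"] a x by auto
  ultimately have "(p, side G p) \<in> linked ?R" if "p \<in> {x, arc G x, side G x, arc G (side G x)}" for p
    using that linked_sym a s x by fastforce
  then have "(p, side G p) \<in> linked ?R" if "p \<in> points G" "label G p = label G x" for p
    using ribbon_graph_edge_points[OF G x] that by blast
  moreover have "sub_surface G S \<subseteq> linked ?R" by (rule subset_linked) blast
  ultimately show "?K' \<subseteq> linked ?R" unfolding sub_surface_def by blast
  have "?R \<subseteq> ?K'" using a s x by (auto simp: sub_surface_def)
  then show "?R \<subseteq> linked ?K'" by (rule subset_linked)
qed

lemma sub_boundary_linked: "sub_boundary G S \<subseteq> linked (sub_surface G S)"
  by (auto simp: sub_boundary_def sub_surface_def strands_def intro!: linked_step)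

text \<open>
  The notation is that of the introduction: \<open>?V\<close>, \<open>?f\<close> and \<open>?k\<close> below are \<open>v\<close>, \<open>f\<close> and \<open>k\<close>, and a prime
  marks their values after the insertion of \<open>e\<close>. The edge disc of \<open>e\<close> has the arcs \<open>x y\<close> and \<open>z w\<close> and the
  sides \<open>x z\<close> and \<open>y w\<close>; whether \<open>e\<close> joins two components is decided by the pair \<open>x\<close>, \<open>z\<close>.
\<close>

lemma euler_bound:
  assumes G: "ribbon_graph G" and S: "finite S" "S \<subseteq> edges G"
  shows "ncomps (points G) (sub_boundary G {}) + ncomps (points G) (sub_boundary G S)
      \<le> card S + 2 * ncomps (points G) (sub_surface G S) \<and>
    (ncomps (points G) (sub_boundary G {}) + ncomps (points G) (sub_boundary G S)
      = card S + 2 * ncomps (points G) (sub_surface G S) \<longrightarrow> (\<exists>c. alternating_on G S c))"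
  using S
proof (induction S)
  case empty
  have "finite (points G)" using G arrow_marked_ribbon_graphD(1) by (auto simp: ribbon_graph_def)
  then have "\<exists>c. alternating_on G {} c"
    using ex_alternating[of "points G" "arc G" "gap G"] ribbon_graph_pairings[OF G]
    by (simp add: alternating_on_def)
  then show ?case by (simp add: sub_boundary_def sub_surface_def)
next
  case (insert e S)
  define P where "P = points G"
  let ?V = "ncomps P (sub_boundary G {})"
  let ?f = "ncomps P (sub_boundary G S)" and ?f' = "ncomps P (sub_boundary G (insert e S))"
  let ?k = "ncomps P (sub_surface G S)" and ?k' = "ncomps P (sub_surface G (insert e S))"
  let ?K = "linked (sub_surface G S)"
  obtain x where x: "x \<in> P" "label G x = e"
    using ribbon_graph_edge_nonempty[OF G] insert.prems unfolding P_def by blast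
  define y z w where "y = arc G x" and "z = side G x" and "w = arc G (side G x)"
  note yzw = y_def z_def w_def
  define Q where "Q = {x, y, z, w}"
  have fin: "finite P" using G arrow_marked_ribbon_graphD(1) by (auto simp: ribbon_graph_def P_def)
  have pa: "pairing P (arc G)" and pg: "pairing P (gap G)" and ps: "pairing P (side G)"
    using ribbon_graph_pairings[OF G] by (auto simp: P_def)
  note s = ribbon_graph_side[OF G, folded P_def]
  have a: "\<And>p. p \<in> P \<Longrightarrow> arc G p \<in> P \<and> arc G p \<noteq> p \<and> arc G (arc G p) = p"
    and ss: "\<And>p. p \<in> P \<Longrightarrow> side G p \<in> P \<and> side G p \<noteq> p \<and> side G (side G p) = p"
    using pa ps by (auto simp: pairing_def)
  have Q: "Q = {q \<in> P. label G q = e}"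
    using ribbon_graph_edge_points[OF G] x by (auto simp: Q_def yzw P_def)
  then have Q_P: "Q \<subseteq> P" by auto
  have mem: "y \<in> P" "z \<in> P" "w \<in> P" using Q_P by (auto simp: Q_def)
  have vals: "arc G x = y" "arc G y = x" "arc G z = w" "arc G w = z"
    "side G x = z" "side G z = x" "side G y = w" "side G w = y"
    using a ss s(3) x mem by (auto simp: yzw)
  have ne: "x \<noteq> y" "x \<noteq> z" "y \<noteq> w" using a ss x mem vals by metis+
  define b where "b p = (if label G p \<in> S then side G p else arc G p)" for p
  define b' where "b' p = (if label G p \<in> insert e S then side G p else arc G p)" for p
  have labs: "label G x = e" "label G y = e" "label G z = e" "label G w = e"
    using Q by (auto simp: Q_def)
  \<comment> \<open>The part of the boundary that is the same before and after the insertion of \<open>e\<close>.\<close>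
  define R0 where "R0 = strands P (gap G) Q b"
  have R0': "R0 = strands P (gap G) Q b'"
    using Q by (auto simp: R0_def strands_def b_def b'_def)
  have pb: "pairing (P - Q) b"
    unfolding pairing_def
  proof
    fix p assume p: "p \<in> P - Q"
    then have "p \<in> P" "label G p \<noteq> e" using Q by auto
    then show "b p \<in> P - Q \<and> b p \<noteq> p \<and> b (b p) = p"
      using a[of p] ss[of p] s(1,2)[of p] by (auto simp: b_def Q)
  qed
  have f: "linked (sub_boundary G S) = linked (insert (z, w) (insert (x, y) R0))"
    unfolding sub_boundary_def R0_def Q_def b_def P_def[symmetric]
    by (rule linked_strands_unfold) (use mem x vals labs insert.hyps in auto)
  have f': "linked (sub_boundary G (insert e S)) = linked (insert (y, w) (insert (x, z) R0))"
  proof -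
    have "{x, y, z, w} = {x, z, y, w}" by auto
    then show ?thesis
    unfolding sub_boundary_def R0' Q_def b'_def P_def[symmetric]
    by (simp only:, intro linked_strands_unfold) (use mem x vals labs in auto)
  qed
  have k': "linked (sub_surface G (insert e S)) =
      linked (insert (y, w) (insert (x, z) (sub_surface G S)))"
    using linked_sub_surface_insert[OF G, of x S] x by (simp add: yzw P_def)
  have xyK: "(x, y) \<in> ?K" and zwK: "(z, w) \<in> ?K"
    using x mem vals by (auto simp: sub_surface_def strands_def P_def intro!: linked_step)
  have R0K: "linked R0 \<subseteq> ?K"
  proof -
    have "R0 \<subseteq> sub_boundary G S" by (auto simp: R0_def sub_boundary_def strands_def b_def P_def)
    then show ?thesis using sub_boundary_linked by (intro linked_mono) (rule subset_trans)
  qed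
  have IH: "?V + ?f \<le> card S + 2 * ?k"
    "?V + ?f = card S + 2 * ?k \<Longrightarrow> \<exists>c. alternating_on G S c"
    using insert.IH insert.prems by (auto simp: P_def)
  have goal: "?V + ?f' \<le> Suc (card S) + 2 * ?k' \<and>
    (?V + ?f' = Suc (card S) + 2 * ?k' \<longrightarrow> (\<exists>c. alternating_on G (insert e S) c))"
  proof (cases "(x, z) \<in> ?K")
    case True
    then have "(y, w) \<in> linked (insert (x, z) (sub_surface G S))"
      using linked_sym[OF xyK] zwK by (auto simp: linked_insert)
    then have kk: "?k' = ?k"
      using True k' ncomps_insert_linked unfolding ncomps_def by metis
    have ff: "?f' \<le> Suc ?f" "?f' = Suc ?f \<Longrightarrow>
        (x, z) \<in> linked R0 \<and> (x, y) \<notin> linked R0 \<and> (x, w) \<notin> linked R0 \<or>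
        (y, w) \<in> linked R0 \<and> (y, x) \<notin> linked R0 \<and> (y, z) \<notin> linked R0"
      using rewire_increase[OF fin x(1) mem, of R0] f f' by (auto simp: ncomps_def)
    have ex: "\<exists>c. alternating_on G (insert e S) c" if eq: "?V + ?f' = Suc (card S) + 2 * ?k'"
    proof -
      have e: "?V + ?f = card S + 2 * ?k" "?f' = Suc ?f" using eq kk ff(1) IH(1) by linarith+
      obtain c where c: "alternating_on G S c" using IH(2)[OF e(1)] ..
      then have cg: "\<And>p. p \<in> P \<Longrightarrow> c (gap G p) \<noteq> c p" and ca: "\<And>p. p \<in> P \<Longrightarrow> c (arc G p) \<noteq> c p"
        and cb: "\<And>p. p \<in> P - Q \<Longrightarrow> c (b p) \<noteq> c p"
        by (auto simp: alternating_on_def P_def b_def)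
      \<comment> \<open>The strand that a side of \<open>e\<close> closes up makes the orientation change along this side.\<close>
      have opp: "c p \<noteq> c q" if "p \<in> P" "linked R0 `` {p} \<inter> Q = {p, q}" "p \<noteq> q" for p q
        using strand_ends_opposite[OF fin pg pb that(1) _ that(3) cg cb] that(2)
        by (simp add: R0_def)
      have "c x \<noteq> c z \<or> c y \<noteq> c w"
        using ff(2)[OF e(2)]
      proof
        assume "(x, z) \<in> linked R0 \<and> (x, y) \<notin> linked R0 \<and> (x, w) \<notin> linked R0"
        then have "linked R0 `` {x} \<inter> Q = {x, z}" by (auto simp: Q_def)
        then show ?thesis using opp x ne by blast
      next
        assume "(y, w) \<in> linked R0 \<and> (y, x) \<notin> linked R0 \<and> (y, z) \<notin> linked R0"
        then have "linked R0 `` {y} \<inter> Q = {y, w}" by (auto simp: Q_def)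
        then show ?thesis using opp mem ne by blast
      qed
      then have "c (side G p) \<noteq> c p" if "p \<in> Q" for p
        using that ca[OF x(1)] ca[OF mem(2)] vals by (auto simp: Q_def)
      then have "alternating_on G (insert e S) c"
        using c Q by (auto simp: alternating_on_def P_def)
      then show ?thesis by blast
    qed
    show ?thesis by (intro conjI impI ex) (use kk ff(1) IH(1) in linarith)+
  next
    case False
    \<comment> \<open>The strand from \<open>x\<close> ends at a corner in the same component of the subgraph, which leaves \<open>y\<close>.\<close>
    have xyR: "(x, y) \<in> linked R0"
      using strand_other_end[OF fin pg pb, of x] x False R0K linked_sym[OF zwK] linked_trans[of x w "sub_surface G S" z]
      by (auto simp: Q_def R0_def)
    have zwR: "(z, w) \<in> linked R0"
      using strand_other_end[OF fin pg pb, of z] mem(2) False R0K linked_sym[of z x] linked_sym[of z y]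
        linked_trans[OF xyK, of z]
      by (auto simp: Q_def R0_def)
    have nR: "(x, z) \<notin> linked R0" using False R0K by blast
    have ff: "Suc ?f' = ?f"
      using rewire_decrease[OF fin x(1) mem(2) xyR zwR nR] f f' by (simp add: ncomps_def)
    have "(y, w) \<in> linked (insert (x, z) (sub_surface G S))"
      using linked_sym[OF xyK] zwK by (auto simp: linked_insert)
    then have kk: "Suc ?k' = ?k"
      using k' ncomps_insert_linked ncomps_insert_not_linked[OF fin x(1) mem(2) False]
      unfolding ncomps_def by metis
    have ex: "\<exists>c. alternating_on G (insert e S) c" if eq: "?V + ?f' = Suc (card S) + 2 * ?k'"
    proof -
      have "?V + ?f = card S + 2 * ?k" using eq kk ff by linarith
      then obtain c where c: "alternating_on G S c" using IH(2) by blast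
      \<comment> \<open>If \<open>e\<close> would be twisted, the orientation is reversed on the component of \<open>z\<close>.\<close>
      define d where "d p \<longleftrightarrow> c p \<noteq> ((z, p) \<in> ?K \<and> c x = c z)" for p
      have inv: "(p, q) \<in> sub_surface G S \<Longrightarrow> (z, p) \<in> ?K \<longleftrightarrow> (z, q) \<in> ?K" for p q
        by (rule linked_class_invariant)
      have st: "(p, arc G p) \<in> sub_surface G S" "(p, gap G p) \<in> sub_surface G S"
        "label G p \<in> S \<Longrightarrow> (p, side G p) \<in> sub_surface G S" if "p \<in> P" for p
        using that by (auto simp: sub_surface_def strands_def P_def)
      have old: "alternating_on G S d"
        unfolding alternating_on_def P_def[symmetric]
      proof
        fix p assume p: "p \<in> P"
        then show "d (arc G p) \<noteq> d p \<and> d (gap G p) \<noteq> d p \<and> (label G p \<in> S \<longrightarrow> d (side G p) \<noteq> d p)"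
          using c inv[OF st(1)[OF p]] inv[OF st(2)[OF p]] inv[OF st(3)[OF p]]
          by (auto simp: alternating_on_def P_def d_def)
      qed
      have "(z, x) \<notin> ?K" using False linked_sym by metis
      then have "d x \<noteq> d z" by (auto simp: d_def)
      moreover have "d y \<noteq> d x" "d w \<noteq> d z"
        using old x mem vals by (auto simp: alternating_on_def P_def)
      ultimately have "d (side G p) \<noteq> d p" if "p \<in> Q" for p
        using that vals by (auto simp: Q_def)
      then have "alternating_on G (insert e S) d"
        using old Q by (auto simp: alternating_on_def P_def)
      then show ?thesis by blast
    qed
    show ?thesis by (intro conjI impI ex) (use kk ff IH(1) in linarith)+
  qed
  then show ?case using insert.hyps by (simp add: P_def)
qed


lemma orbits_eq_linked_classes:
  assumes F: "\<And>f p. f \<in> F \<Longrightarrow> p \<in> X \<Longrightarrow> f p \<in> X \<and> f (f p) = p"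
    and R: "R = (\<Union>f\<in>F. {(p, f p) |p. p \<in> X})"
  shows "orbits F X = X // linked R"
proof -
  let ?M = "{(p, q). \<exists>f\<in>F. q = f p}"
  have "?M\<^sup>* `` {p} = linked R `` {p}" if p: "p \<in> X" for p
  proof
    show "linked R `` {p} \<subseteq> ?M\<^sup>* `` {p}"
    proof -
      have "R \<union> R\<inverse> \<subseteq> ?M"
      proof
        fix r assume "r \<in> R \<union> R\<inverse>"
        then obtain f p where f: "f \<in> F" "p \<in> X" "r = (p, f p) \<or> r = (f p, p)" by (auto simp: R)
        moreover have "p = f (f p)" using F[OF f(1,2)] by simp
        ultimately show "r \<in> ?M" by blast
      qed
      then show ?thesis unfolding linked_def using rtrancl_mono by blast
    qed
    show "?M\<^sup>* `` {p} \<subseteq> linked R `` {p}"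
    proof
      fix q assume "q \<in> ?M\<^sup>* `` {p}"
      then have "(p, q) \<in> ?M\<^sup>*" by simp
      then have "q \<in> X \<and> (p, q) \<in> linked R"
      proof induction
        case base
        then show ?case using p by simp
      next
        case (step q r)
        then obtain f where f: "f \<in> F" "r = f q" by auto
        then have "(q, r) \<in> R" using step.IH by (auto simp: R)
        then show ?case using step.IH f F linked_step[of q r R] linked_trans[of p q R r] by auto
      qed
      then show "q \<in> linked R `` {p}" by simp
    qed
  qed
  then show ?thesis by (auto simp: orbits_def quotient_def)
qed

lemma vertex_orbits_linked:
  assumes "ribbon_graph G"
  shows "vertex_orbits G = points G // linked (sub_boundary G {})"
  unfolding vertex_orbits_def
  by (rule orbits_eq_linked_classes)
    (use ribbon_graph_pairings[OF assms] in \<open>auto simp: sub_boundary_def strands_def pairing_def\<close>)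

lemma linked_vertex_points:
  assumes "ribbon_graph G" "(p, q) \<in> linked (sub_boundary G {})" "p \<in> points G"
  shows "q \<in> points G"
  using assms(2,3)
  by (rule linked_closed)
    (use ribbon_graph_pairings[OF assms(1)] in \<open>auto simp: sub_boundary_def strands_def pairing_def\<close>)

text \<open>
  For the full edge set the bound of \<open>euler_bound\<close> is attained, since \<open>k = 1\<close>. A graph with a single bare
  vertex has no points, so nothing needs to be coloured.
\<close>

lemma plane_graph_orientable:
  assumes "plane_graph G"
  obtains c where "alternating_on G (edges G) c"
proof (cases "points G = {}")
  case True
  then show ?thesis using that by (simp add: alternating_on_def)
next
  case False
  let ?P = "points G" and ?E = "edges G"
  have G: "ribbon_graph G" and comp: "card (components G) = 1" and chi: "euler_characteristic G = 2"
    using assms by (auto simp: plane_graph_def)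
  note lab = ribbon_graph_edge_label[OF G]
  note s = ribbon_graph_side[OF G]
  note pair = ribbon_graph_pairings[OF G, unfolded pairing_def]
  have fin: "finite ?P" "finite ?E" using G arrow_marked_ribbon_graphD(1,2) by (auto simp: ribbon_graph_def)
  have finq: "finite (orbits F ?P)" for F
    unfolding orbits_def quotient_def using fin by simp
  have V: "orbits {arc G, gap G} ?P = ?P // linked (sub_boundary G {})"
    using vertex_orbits_linked[OF G] by (simp add: vertex_orbits_def)
  have B: "orbits {arc (dual G), gap (dual G)} (points (dual G)) = ?P // linked (sub_boundary G ?E)"
  proof -
    have "points (dual G) = ?P" by (simp add: dual_def)
    then show ?thesis
      by (simp only:, intro orbits_eq_linked_classes)
        (use pair lab s in \<open>auto simp: dual_def sub_boundary_def strands_def\<close>)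
  qed
  have K: "orbits {arc G, gap G, side G} ?P = ?P // linked (sub_surface G ?E)"
    by (rule orbits_eq_linked_classes) (use pair lab in \<open>auto simp: sub_surface_def strands_def\<close>)
  have "card (orbits {arc G, gap G, side G} ?P) + bare G = 1"
    using comp finq by (simp add: components_def card_Plus)
  moreover have "card (orbits {arc G, gap G, side G} ?P) \<noteq> 0"
    using False finq[of "{arc G, gap G, side G}"] by (auto simp: orbits_def quotient_def)
  ultimately have k: "ncomps ?P (sub_surface G ?E) = 1" and bare: "bare G = 0"
    unfolding ncomps_def K[symmetric] by auto
  have "int (ncomps ?P (sub_boundary G {})) - int (card ?E) + int (ncomps ?P (sub_boundary G ?E)) = 2"
  proof -
    have "bare (dual G) = 0" using bare by (simp add: dual_def)
    moreover have "points (dual G) = ?P" by (simp add: dual_def)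
    then have "finite (orbits {arc (dual G), gap (dual G)} (points (dual G)))" using finq by simp
    ultimately show ?thesis
      using chi bare finq[of "{arc G, gap G}"] V B
      by (simp add: euler_characteristic_def verts_def vertex_orbits_def card_Plus ncomps_def)
  qed
  then have "ncomps ?P (sub_boundary G {}) + ncomps ?P (sub_boundary G ?E)
      = card ?E + 2 * ncomps ?P (sub_surface G ?E)" using k by linarith
  then show ?thesis using euler_bound[OF G fin(2)] that by blast
qed


section \<open>Bipartite partial duals\<close>

text \<open>
  A set of vertices is the same as a set of points that is closed under arcs and gaps. An edge has its
  two ends at the vertices of \<open>p\<close> and of \<open>side G p\<close>.
\<close>

lemma bipartite_iff_colouring:
  fixes G :: "('p, 'e) ribbon"
  assumes G: "ribbon_graph G"
  shows "bipartite G \<longleftrightarrow> (\<exists>c :: 'p \<Rightarrow> bool. \<forall>p\<in>points G.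
    c (arc G p) = c p \<and> c (gap G p) = c p \<and> c (side G p) \<noteq> c p)"
proof -
  let ?P = "points G"
  define L where "L = linked (sub_boundary G {})"
  note lab = ribbon_graph_edge_label[OF G]
  note pair = ribbon_graph_pairings[OF G, unfolded pairing_def]
  have V: "vertex_orbits G = ?P // L"
    unfolding L_def by (rule vertex_orbits_linked[OF G])
  have cls: "L `` {p} = L `` {q} \<longleftrightarrow> (p, q) \<in> L" for p q
    unfolding L_def by (rule eq_equiv_class_iff[OF equiv_linked UNIV_I UNIV_I])
  have step: "L `` {arc G p} = L `` {p}" "L `` {gap G p} = L `` {p}" if "p \<in> ?P" for p
    unfolding cls using that
    by (auto simp: L_def sub_boundary_def strands_def intro!: linked_sym[OF linked_step])
  have ends: "ends G (label G p) = {Inl (L `` {p}), Inl (L `` {side G p})}" if p: "p \<in> ?P" for p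
  proof -
    have "ends G (label G p) = (\<lambda>q. Inl (L `` {q})) ` {q \<in> ?P. label G q = label G p}"
    proof (intro set_eqI iffI)
      fix v :: "'p set + nat" assume "v \<in> ends G (label G p)"
      then obtain q r where v: "v = Inl (L `` {q})" and q: "q \<in> ?P"
        and r: "(q, r) \<in> L" "label G r = label G p"
        unfolding ends_def V quotient_def by auto
      from r(1) q have "r \<in> ?P" unfolding L_def by (rule linked_vertex_points[OF G])
      moreover have "L `` {q} = L `` {r}" using r(1) cls by blast
      ultimately show "v \<in> (\<lambda>q. Inl (L `` {q})) ` {q \<in> ?P. label G q = label G p}"
        using v r(2) by blast
    next
      fix v :: "'p set + nat" assume "v \<in> (\<lambda>q. Inl (L `` {q})) ` {q \<in> ?P. label G q = label G p}"
      then obtain q where q: "q \<in> ?P" "label G q = label G p" "v = Inl (L `` {q})" by auto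
      moreover have "q \<in> L `` {q}" by (simp add: L_def)
      ultimately show "v \<in> ends G (label G p)" unfolding ends_def V quotient_def by blast
    qed
    also have "\<dots> = {Inl (L `` {p}), Inl (L `` {side G p})}"
      unfolding ribbon_graph_edge_points[OF G p] using step p pair by auto
    finally show ?thesis .
  qed
  show ?thesis
  proof
    assume "bipartite G"
    then obtain X Y where XY: "X \<inter> Y = {}"
      "\<forall>e\<in>edges G. \<exists>x\<in>X. \<exists>y\<in>Y. ends G e = {x, y}"
      unfolding bipartite_def by (elim exE conjE) (rule that)
    define c where "c p \<longleftrightarrow> Inl (L `` {p}) \<in> X" for p
    have "c (arc G p) = c p \<and> c (gap G p) = c p \<and> c (side G p) \<noteq> c p" if p: "p \<in> ?P" for p
    proof -
      obtain x y where "x \<in> X" "y \<in> Y" "{Inl (L `` {p}), Inl (L `` {side G p})} = {x, y}"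
        using bspec[OF XY(2) lab[OF p]] ends[OF p] by metis
      then have "c (side G p) \<noteq> c p" using XY(1) by (auto simp: c_def doubleton_eq_iff)
      then show ?thesis using step[OF p] by (simp add: c_def)
    qed
    then show "\<exists>c :: 'p \<Rightarrow> bool. \<forall>p\<in>?P. c (arc G p) = c p \<and> c (gap G p) = c p \<and> c (side G p) \<noteq> c p"
      by (intro exI[of _ c] ballI)
  next
    assume "\<exists>c :: 'p \<Rightarrow> bool. \<forall>p\<in>?P. c (arc G p) = c p \<and> c (gap G p) = c p \<and> c (side G p) \<noteq> c p"
    then obtain c :: "'p \<Rightarrow> bool" where c: "\<And>p. p \<in> ?P \<Longrightarrow> c (arc G p) = c p \<and> c (gap G p) = c p \<and> c (side G p) \<noteq> c p"
      by (elim exE) (rule that, rule bspec)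
    have const: "c q = c p" if "(p, q) \<in> L" "p \<in> ?P" for p q
    proof -
      have "q \<in> {r \<in> ?P. c r = c p}"
        using that(1) unfolding L_def
        by (rule linked_closed) (use that(2) c pair in \<open>auto simp: sub_boundary_def strands_def\<close>)
      then show ?thesis by simp
    qed
    define X :: "('p set + nat) set" where "X = {Inl (L `` {p}) |p. p \<in> ?P \<and> c p}"
    have mem: "Inl (L `` {p}) \<in> X \<longleftrightarrow> c p" if p: "p \<in> ?P" for p
      using const p cls by (fastforce simp: X_def)
    have sub: "X \<subseteq> verts G" unfolding X_def verts_def V quotient_def by auto
    have "\<exists>x\<in>X. \<exists>y\<in>verts G - X. ends G e = {x, y}" if "e \<in> edges G" for e
    proof -
      obtain p where p: "p \<in> ?P" "label G p = e" using ribbon_graph_edge_nonempty[OF G \<open>e \<in> edges G\<close>] .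
      have q: "side G p \<in> ?P" using pair p by blast
      have v: "Inl (L `` {p}) \<in> verts G" "Inl (L `` {side G p}) \<in> verts G"
        using p q by (auto simp: verts_def V quotient_def)
      have "ends G e = {Inl (L `` {p}), Inl (L `` {side G p})}" 
        "ends G e = {Inl (L `` {side G p}), Inl (L `` {p})}" using ends[OF p(1)] p(2) by auto
      moreover have "c (side G p) \<noteq> c p" using c p by blast
      ultimately show ?thesis using mem[OF p(1)] mem[OF q] v by blast
    qed
    moreover have "X \<union> (verts G - X) = verts G" "X \<inter> (verts G - X) = {}" using sub by auto
    ultimately show "bipartite G" unfolding bipartite_def by blast
  qed
qed

lemma partial_dual_swap:
  assumes G: "ribbon_graph G" and A: "A \<subseteq> edges G"
  shows "partial_dual G A = G\<lparr>arc := (\<lambda>p. if label G p \<in> A then side G p else arc G p),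
      side := (\<lambda>p. if label G p \<in> A then arc G p
                   else if p \<notin> points G \<and> label G p \<in> edges G - A then p else side G p)\<rparr>"
proof -
  obtain H where H: "boundary_orientation G (edges G - A) H"
    using ex_boundary_orientation[OF G, of "edges G - A"] by blast
  show ?thesis
    unfolding partial_dual_eq[OF G A H] by (rule partial_dual_choice[OF G A refl H])
qed

lemma ribbon_graph_partial_dual:
  assumes G: "ribbon_graph G" and A: "A \<subseteq> edges G"
  shows "ribbon_graph (partial_dual G A)"
proof -
  have am: "arrow_marked_ribbon_graph G" "marks G = {}" using G by (auto simp: ribbon_graph_def)
  have hd: "heads G = {}" using arrow_marked_ribbon_graphD(9)[OF am(1)] am(2) by auto
  note s = ribbon_graph_side[OF G]
  note pair = ribbon_graph_pairings[OF G, unfolded pairing_def]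
  show ?thesis
    unfolding ribbon_graph_def arrow_marked_ribbon_graph_def partial_dual_swap[OF G A]
    using arrow_marked_ribbon_graphD(1,2,7)[OF am(1)] ribbon_graph_edge_label[OF G] am(2) hd s pair
      not_sym[OF s(4)]
    by (auto split: if_splits)
qed

lemma bipartite_partial_dual_iff:
  fixes G :: "('p, 'e) ribbon"
  assumes G: "ribbon_graph G" and A: "A \<subseteq> edges G"
  shows "bipartite (partial_dual G A) \<longleftrightarrow> (\<exists>c :: 'p \<Rightarrow> bool. \<forall>p\<in>points G. c (gap G p) = c p \<and>
    (if label G p \<in> A then c (side G p) = c p \<and> c (arc G p) \<noteq> c p
     else c (arc G p) = c p \<and> c (side G p) \<noteq> c p))"
  unfolding bipartite_iff_colouring[OF ribbon_graph_partial_dual[OF assms]]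
  unfolding partial_dual_swap[OF assms]
  by (intro arg_cong[where f = Ex] ext ball_cong) auto


section \<open>All-crossing directions\<close>

text \<open>The edge-end through \<open>p\<close> is the set \<open>{(p, True), (p, False)}\<close>.\<close>

abbreviation is_head :: "('p \<times> bool) set set \<Rightarrow> 'p \<Rightarrow> bool" where
  "is_head D p \<equiv> {p} \<times> UNIV \<in> D"

lemma edge_end_medial: "edge_end (medial G) (p, b) = {p} \<times> UNIV"
  by (auto simp: edge_end_def medial_def)

lemma direction_medial_iff:
  "direction (medial G) D \<longleftrightarrow> D \<subseteq> (\<lambda>p. {p} \<times> UNIV) ` points G \<and>
    (\<forall>p\<in>points G. is_head D p \<longleftrightarrow> \<not> is_head D (gap G p))"
proof -
  have "edge_end (medial G) ` points (medial G) = (\<lambda>p. {p} \<times> UNIV) ` points G"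
    by (force simp: medial_def edge_end_medial[unfolded medial_def])
  then show ?thesis unfolding direction_def
    by (auto simp: edge_end_medial medial_def edge_end_medial[unfolded medial_def])
qed

lemma next_end_medial:
  "next_end (medial G) (p, b) = (if b then arc G p else side G p, \<not> b)"
  by (simp add: next_end_def medial_def)

text \<open>
  The edge-ends around the medial vertex on an edge disc of \<open>G\<close> are the corners of this disc in cyclic
  order, so heads and tails form two adjacent pairs: the two heads span either an arc or a side.
\<close>

lemma all_crossing_medial_iff:
  assumes G: "ribbon_graph G"
  shows "all_crossing_direction (medial G) D \<longleftrightarrow> direction (medial G) D \<and>
    (\<forall>e\<in>edges G. (\<forall>p\<in>points G. label G p = e \<longrightarrow> is_head D (arc G p) = is_head D p \<and> is_head D (side G p) \<noteq> is_head D p) \<or>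
     (\<forall>p\<in>points G. label G p = e \<longrightarrow> is_head D (arc G p) \<noteq> is_head D p \<and> is_head D (side G p) = is_head D p))"
proof -
  note s = ribbon_graph_side[OF G]
  note pair = ribbon_graph_pairings[OF G, unfolded pairing_def]
  have "(\<exists>x\<in>medial_vertex G e. edge_end (medial G) x \<in> D \<and>
        edge_end (medial G) (next_end (medial G) x) \<in> D \<and>
        edge_end (medial G) (next_end (medial G) (next_end (medial G) x)) \<notin> D \<and>
        edge_end (medial G) (next_end (medial G) (next_end (medial G) (next_end (medial G) x))) \<notin> D)
     \<longleftrightarrow> (\<forall>p\<in>points G. label G p = e \<longrightarrow> is_head D (arc G p) = is_head D p \<and> is_head D (side G p) \<noteq> is_head D p) \<or>
     (\<forall>p\<in>points G. label G p = e \<longrightarrow> is_head D (arc G p) \<noteq> is_head D p \<and> is_head D (side G p) = is_head D p)"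
    (is "?L \<longleftrightarrow> ?R") if e: "e \<in> edges G" for e
  proof -
    \<comment> \<open>Starting at \<open>(p, True)\<close> and at \<open>(p, False)\<close> runs through the corners in the two directions.\<close>
    have rot: "?L \<longleftrightarrow> (\<exists>p\<in>{p \<in> points G. label G p = e}.
        is_head D p \<and> is_head D (arc G p) \<and> \<not> is_head D (side G (arc G p)) \<and> \<not> is_head D (arc G (side G (arc G p))) \<or>
        is_head D p \<and> is_head D (side G p) \<and> \<not> is_head D (arc G (side G p)) \<and> \<not> is_head D (side G (arc G (side G p))))"
      unfolding medial_vertex_def
      by (auto simp: next_end_medial edge_end_medial UNIV_bool ex_disj_distrib)
    obtain x where x: "x \<in> points G" "label G x = e" using ribbon_graph_edge_nonempty[OF G e] .
    define y z w where yzw: "y = arc G x" "z = side G x" "w = arc G (side G x)"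
    have Q: "{q \<in> points G. label G q = e} = {x, y, z, w}"
      using ribbon_graph_edge_points[OF G] x by (auto simp: yzw)
    then have mem: "y \<in> points G" "z \<in> points G" "w \<in> points G" by auto
    have vals: "arc G x = y" "arc G y = x" "arc G z = w" "arc G w = z"
      "side G x = z" "side G z = x" "side G y = w" "side G w = y"
      using pair s(3) x mem by (auto simp: yzw)
    have R: "?R \<longleftrightarrow>
       (\<forall>p\<in>{q \<in> points G. label G q = e}. is_head D (arc G p) = is_head D p \<and> is_head D (side G p) \<noteq> is_head D p) \<or>
       (\<forall>p\<in>{q \<in> points G. label G q = e}. is_head D (arc G p) \<noteq> is_head D p \<and> is_head D (side G p) = is_head D p)"
      by blast
    show ?thesis unfolding rot R Q by (simp add: vals) blast
  qed
  then show ?thesis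
    unfolding all_crossing_direction_def vertex_orbits_medial[OF G] by (simp cong: ball_cong)
qed

lemma c_edges_medial:
  assumes G: "ribbon_graph G"
  shows "c_edges G D = {e \<in> edges G. \<forall>p\<in>points G. label G p = e \<longrightarrow>
    (is_head D p \<longleftrightarrow> is_head D (arc G p))}"
proof -
  have "\<Union> (vertex_orbits G) = points G"
    unfolding vertex_orbits_linked[OF G] quotient_def
    using linked_vertex_points[OF G] by (auto intro: linked_refl)
  then have "\<Union> (black_faces G) = points G \<times> {True}" unfolding black_faces_def by auto
  then have black: "medial_vertex G e \<inter> \<Union> (black_faces G) = {p \<in> points G. label G p = e} \<times> {True}" for e
    by (auto simp: medial_vertex_def)
  have gap: "gap (medial G) (p, True) = (arc G p, True)" for p by (simp add: medial_def)
  show ?thesis unfolding c_edges_def c_vertex_def black by (auto simp: edge_end_medial gap)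
qed

lemma all_crossing_c_edges_iff:
  fixes G :: "('p, 'e) ribbon"
  assumes G: "ribbon_graph G" and A: "A \<subseteq> edges G"
  shows "(\<exists>D. all_crossing_direction (medial G) D \<and> A = c_edges G D) \<longleftrightarrow>
    (\<exists>d :: 'p \<Rightarrow> bool. \<forall>p\<in>points G. d (gap G p) \<noteq> d p \<and>
    (if label G p \<in> A then d (arc G p) = d p \<and> d (side G p) \<noteq> d p
     else d (arc G p) \<noteq> d p \<and> d (side G p) = d p))" (is "?L \<longleftrightarrow> ?R")
proof
  assume ?L
  then obtain D where D: "all_crossing_direction (medial G) D" and AD: "A = c_edges G D" by blast
  define d where "d p \<longleftrightarrow> is_head D p" for p
  note D' = D[unfolded all_crossing_medial_iff[OF G] direction_medial_iff, folded d_def]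
  note A' = AD[unfolded c_edges_medial[OF G], folded d_def]
  have "d (gap G p) \<noteq> d p \<and> (if label G p \<in> A then d (arc G p) = d p \<and> d (side G p) \<noteq> d p
     else d (arc G p) \<noteq> d p \<and> d (side G p) = d p)" if p: "p \<in> points G" for p
  proof -
    have e: "label G p \<in> edges G" using ribbon_graph_edge_label[OF G p] .
    have g: "d (gap G p) \<noteq> d p" using D' p by blast
    from D' e consider
      "\<And>q. q \<in> points G \<Longrightarrow> label G q = label G p \<Longrightarrow> d (arc G q) = d q \<and> d (side G q) \<noteq> d q" |
      "\<And>q. q \<in> points G \<Longrightarrow> label G q = label G p \<Longrightarrow> d (arc G q) \<noteq> d q \<and> d (side G q) = d q"
      by blast
    then show ?thesis
    proof cases
      case 1
      then have "label G p \<in> A" using A' e by auto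
      then show ?thesis using 1[OF p] g by simp
    next
      case 2
      then have "label G p \<notin> A" using A' p by auto
      then show ?thesis using 2[OF p] g by simp
    qed
  qed
  then show ?R by (intro exI[of _ d] ballI)
next
  assume ?R
  then obtain d :: "'p \<Rightarrow> bool" where d: "\<And>p. p \<in> points G \<Longrightarrow> d (gap G p) \<noteq> d p \<and>
    (if label G p \<in> A then d (arc G p) = d p \<and> d (side G p) \<noteq> d p
     else d (arc G p) \<noteq> d p \<and> d (side G p) = d p)" by blast
  note pair = ribbon_graph_pairings[OF G, unfolded pairing_def]
  define D where "D = (\<lambda>p. {p} \<times> (UNIV :: bool set)) ` {p \<in> points G. d p}"
  have mem: "is_head D p \<longleftrightarrow> d p" if "p \<in> points G" for p
    using that by (auto simp: D_def times_eq_iff)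
  have "direction (medial G) D"
    unfolding direction_medial_iff using mem d pair by (auto simp: D_def)
  then have "all_crossing_direction (medial G) D"
    unfolding all_crossing_medial_iff[OF G]
  proof (intro conjI ballI)
    fix e
    show "(\<forall>p\<in>points G. label G p = e \<longrightarrow> is_head D (arc G p) = is_head D p \<and>
          is_head D (side G p) \<noteq> is_head D p) \<or>
        (\<forall>p\<in>points G. label G p = e \<longrightarrow> is_head D (arc G p) \<noteq> is_head D p \<and>
          is_head D (side G p) = is_head D p)"
      using d pair mem by (cases "e \<in> A") simp_all
  qed
  moreover have "A = c_edges G D"
  proof -
    have "e \<in> A \<longleftrightarrow> e \<in> edges G \<and> (\<forall>p\<in>points G. label G p = e \<longrightarrow> d p = d (arc G p))" for e
    proof (cases "e \<in> edges G")
      case True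
      then obtain p where "p \<in> points G" "label G p = e" using ribbon_graph_edge_nonempty[OF G] by metis
      moreover have "d (arc G q) = d q \<longleftrightarrow> e \<in> A" if "q \<in> points G" "label G q = e" for q
        using d[OF that(1)] that(2) by (auto split: if_splits)
      ultimately show ?thesis using True by metis
    qed (use A in auto)
    then show ?thesis unfolding c_edges_medial[OF G] using mem pair by auto
  qed
  ultimately show ?L by blast
qed

theorem theorem3:
  fixes G :: "('p, 'e) ribbon" and A :: "'e set"
  assumes "plane_graph G" and "A \<subseteq> edges G"
  shows "bipartite (partial_dual G A) \<longleftrightarrow>
    (\<exists>D. all_crossing_direction (medial G) D \<and> A = c_edges G D)"
proof -
  have G: "ribbon_graph G" using assms(1) by (simp add: plane_graph_def)
  obtain u where "alternating_on G (edges G) u" using plane_graph_orientable[OF assms(1)] .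
  then have u: "u (arc G p) \<noteq> u p" "u (gap G p) \<noteq> u p" "u (side G p) \<noteq> u p" if "p \<in> points G" for p
    using that ribbon_graph_edge_label[OF G] by (auto simp: alternating_on_def)
  \<comment> \<open>An involution that exchanges the two kinds of colourings.\<close>
  define twist where "twist c p \<longleftrightarrow> c p \<noteq> u p" for c :: "'p \<Rightarrow> bool" and p
  define P where "P c \<longleftrightarrow> (\<forall>p\<in>points G. c (gap G p) = c p \<and>
    (if label G p \<in> A then c (side G p) = c p \<and> c (arc G p) \<noteq> c p
     else c (arc G p) = c p \<and> c (side G p) \<noteq> c p))" for c :: "'p \<Rightarrow> bool"
  define Q where "Q d \<longleftrightarrow> (\<forall>p\<in>points G. d (gap G p) \<noteq> d p \<and>
    (if label G p \<in> A then d (arc G p) = d p \<and> d (side G p) \<noteq> d p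
     else d (arc G p) \<noteq> d p \<and> d (side G p) = d p))" for d :: "'p \<Rightarrow> bool"
  have "P c \<longleftrightarrow> Q (twist c)" for c
    unfolding P_def Q_def twist_def by (intro ball_cong refl) (use u in auto)
  moreover have "twist (twist c) = c" for c by (auto simp: twist_def)
  ultimately have "(\<exists>c. P c) \<longleftrightarrow> (\<exists>d. Q d)" by metis
  then show ?thesis
    unfolding bipartite_partial_dual_iff[OF G assms(2)] all_crossing_c_edges_iff[OF G assms(2)]
    by (simp add: P_def Q_def)
qed

end
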